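(* Let $G$ be a subgroup of $SU_2$, $G\ne\{\mathbf 1\},\{\mathbf 1,-\mathbf 1\}$, with natural module $V=\mathbb C^2$, and let $Z_k=\mathrm{End}_G(V^{\otimes k})$ for all $k$. Let $\lambda\in\Lambda_k(G)$, and assume the idempotent $\mathsf f_\lambda\in Z_k$ projects $V^{\otimes k}$ onto the irreducible $G$-module $G^\lambda$ in $V^{\otimes k}_{\mathrm{new}}$; suppose $G^\lambda\otimes V=\bigoplus_iG^{\mu_i}$ with each $G^{\mu_i}$ irreducible, and let $\mathsf f_{\mu_i}$ be the orthogonal idempotents in $Z_{k+1}$ that project $V^{\otimes(k+1)}$ onto the irreducible $G$-modules $G^{\mu_i}$. Write $d^\alpha=\dim G^\alpha$. Let $\mu=\mu_i\in\Lambda_{k+1}(G)\setminus\Lambda_{k-1}(G)$ for some $i$. Suppose $G^\mu\otimes V=G^\lambda\oplus G^\nu$, where $G^\nu$ is an irreducible $G$-module of dimension $d^\nu$ and $\nu\in\Lambda_{k+2}(G)\setminus\Lambda_k(G)$. Set $$\mathsf f_\nu=\mathsf f_\mu-\frac{d^\lambda}{d^\mu}\,\mathsf f_\mu\,\mathsf e_{k+1}\,\mathsf f_\mu .$$ Then: (i) $\mathsf f_\nu$ is an idempotent in $Z_{k+2}$; (ii) $\mathsf f_\mu\mathsf f_\nu=\mathsf f_\nu=\mathsf f_\nu\mathsf f_\mu$; (iii) $\mathsf f_\nu$ commutes with $\mathsf e_j$ for $j>k+2$; (iv) $\mathsf e_{k+2}\mathsf f_\nu\mathsf e_{k+2}=\dfrac{d^\nu}{d^\mu}\,\mathsf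 f_\mu\,\mathsf e_{k+2}$, so that $\varepsilon_{k+2}(\mathsf f_\nu)=\dfrac{d^\nu}{2d^\mu}\,\mathsf f_\mu$; (v) $\mathsf f_\nu$ projects $V^{\otimes(k+2)}$ onto $G^\nu$.
   Context: $V=\mathbb C^2$ has standard basis $v_{-1}=(1,0)^t$, $v_1=(0,1)^t$; $G$ acts diagonally on $V^{\otimes k}$ ($V^{\otimes 0}$ is the trivial module). It is assumed that all $V^{\otimes k}$ are completely reducible; $\{G^\lambda\mid\lambda\in\Lambda(G)\}$ is a complete set of pairwise non-isomorphic irreducible $G$-modules occurring in some $V^{\otimes k}$, and $\Lambda_k(G)$ is the set of $\lambda$ such that $G^\lambda$ occurs in $V^{\otimes k}$ ($\Lambda_j(G)=\emptyset$ for $j<0$). One has $\Lambda_{k}(G)\subseteq\Lambda_{k+2}(G)$. Write $V^{\otimes k}=V^{\otimes k}_{\mathrm{old}}\oplus V^{\otimes k}_{\mathrm{new}}$, where $V^{\otimes k}_{\mathrm{old}}$ is the sum of the $G^\lambda$-isotypic components with $\lambda\in\Lambda_{k-2}(G)$ and $V^{\otimes k}_{\mathrm{new}}$ is the sum of those with $\lambda\in\Lambda_k(G)\setminus\Lambda_{k-2}(G)$. Writing $G^\lambda\otimes V\cong\bigoplus_\mu a_{\lambda,\mu}G^\mu$, it is assumed (and it holds for finite $G$) that $a_{\lambda,\mu}=a_{\mu,\lambda}\in\{0,1\}$ and $a_{\lambda,\lambda}=0$ for $\lambda\neq0$. $\mathrm{End}(V^{\otimes k})$ is embedded in $\mathrm{End}(V^{\otimes(k+1)})$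 by $a\mapsto a\otimes\mathbf 1$ (so $Z_k\subseteq Z_{k+1}$), and products of elements of different levels are taken via these embeddings. $\mathsf e:V\otimes V\to V\otimes V$ is $\mathsf e(v_\ell\otimes v_m)=v_\ell\otimes v_m-v_m\otimes v_\ell$, and $\mathsf e_i$ acts as $\mathsf e$ in tensor positions $i,i+1$ and as identity elsewhere. The conditional expectation $\varepsilon_k:\mathrm{End}(V^{\otimes k})\to\mathrm{End}(V^{\otimes(k-1)})$ is $\varepsilon_k(a)^{\mathsf p}_{\mathsf q}=\tfrac12\big(a^{[\mathsf p,-1]}_{[\mathsf q,-1]}+a^{[\mathsf p,1]}_{[\mathsf q,1]}\big)$ for $\mathsf p,\mathsf q\in\{-1,1\}^{k-1}$, where $a^{\mathsf r}_{\mathsf s}$ are matrix entries in the basis $v_{\mathsf r}=v_{r_1}\otimes\cdots\otimes v_{r_k}$, i.e. $av_{\mathsf s}=\sum_{\mathsf r} a^{\mathsf r}_{\mathsf s}v_{\mathsf r}$, and $[\mathsf p,t]$ is concatenation. *)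

theory Defs
  imports "HOL-Analysis.Analysis" "HOL-Algebra.Group" "HOL-Library.Function_Algebras"
begin

definition SU2 :: "(complex^2^2) monoid" where
  "SU2 = \<lparr>carrier = {g. det g = 1 \<and> g ** map_matrix cnj (transpose g) = mat 1},
          mult = (**), one = mat 1\<rparr>"

lemma group_SU2: "group SU2"
proof (rule groupI)
  let ?ad = "\<lambda>g :: complex^2^2. map_matrix cnj (transpose g)"
  have ad_mult: "?ad (g ** h) = ?ad h ** ?ad g" for g h
    by (simp add: vec_eq_iff map_matrix_def transpose_def matrix_matrix_mult_def mult.commute)
  have ad_ad: "?ad (?ad g) = g" for g
    by (simp add: vec_eq_iff map_matrix_def transpose_def)
  have det_ad: "det (?ad g) = cnj (det g)" for g
    by (simp add: det_2 map_matrix_def transpose_def)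
  have ad_one: "?ad (mat 1) = mat 1"
    by (simp add: vec_eq_iff map_matrix_def transpose_def mat_def)
  fix x y z
  assume x: "x \<in> carrier SU2"
  then have x': "?ad x ** x = mat 1"
    by (simp add: SU2_def matrix_left_right_inverse)
  show "\<one>\<^bsub>SU2\<^esub> \<otimes>\<^bsub>SU2\<^esub> x = x" by (simp add: SU2_def)
  show "\<exists>y\<in>carrier SU2. y \<otimes>\<^bsub>SU2\<^esub> x = \<one>\<^bsub>SU2\<^esub>"
    using x x' by (intro bexI[of _ "?ad x"]) (auto simp: SU2_def det_ad ad_ad)
  assume y: "y \<in> carrier SU2"
  have "(x ** y) ** (?ad y ** ?ad x) = x ** (y ** ?ad y) ** ?ad x"
    by (simp add: matrix_mul_assoc)
  then show "x \<otimes>\<^bsub>SU2\<^esub> y \<in> carrier SU2"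
    using x y by (simp add: SU2_def det_mul ad_mult)
  show "x \<otimes>\<^bsub>SU2\<^esub> y \<otimes>\<^bsub>SU2\<^esub> z = x \<otimes>\<^bsub>SU2\<^esub> (y \<otimes>\<^bsub>SU2\<^esub> z)"
    by (simp add: SU2_def matrix_mul_assoc)
next
  show "\<one>\<^bsub>SU2\<^esub> \<in> carrier SU2"
  proof -
    have "map_matrix cnj (transpose (mat 1)) = (mat 1 :: complex^2^2)"
      by (simp add: vec_eq_iff map_matrix_def transpose_def mat_def)
    then show ?thesis by (simp add: SU2_def)
  qed
qed

text \<open>Vector spaces are complex subspaces of function spaces \<open>'b \<Rightarrow> complex\<close>.\<close>

definition cscale :: "complex \<Rightarrow> ('b \<Rightarrow> complex) \<Rightarrow> 'b \<Rightarrow> complex" where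
  "cscale c x = (\<lambda>b. c * x b)"

global_interpretation cfun: vector_space "cscale :: complex \<Rightarrow> ('b \<Rightarrow> complex) \<Rightarrow> 'b \<Rightarrow> complex"
  by unfold_locales (auto simp: cscale_def fun_eq_iff algebra_simps)

definition linear_on :: "('b \<Rightarrow> complex) set \<Rightarrow> (('b \<Rightarrow> complex) \<Rightarrow> ('c \<Rightarrow> complex)) \<Rightarrow> bool" where
  "linear_on W f \<longleftrightarrow> (\<forall>x\<in>W. \<forall>y\<in>W. f (x + y) = f x + f y) \<and>
     (\<forall>c. \<forall>x\<in>W. f (cscale c x) = cscale c (f x))"

definition is_direct_sum :: "('b \<Rightarrow> complex) set \<Rightarrow> 'i set \<Rightarrow> ('i \<Rightarrow> ('b \<Rightarrow> complex) set) \<Rightarrow> bool" where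
  "is_direct_sum W I U \<longleftrightarrow> finite I \<and> (\<forall>i\<in>I. cfun.subspace (U i) \<and> U i \<subseteq> W) \<and>
     (\<forall>x\<in>W. \<exists>!u. (\<forall>i\<in>I. u i \<in> U i) \<and> (\<forall>i. i \<notin> I \<longrightarrow> u i = 0) \<and> x = (\<Sum>i\<in>I. u i))"


record 'b gmod =
  gspace :: "('b \<Rightarrow> complex) set"
  gact :: "complex^2^2 \<Rightarrow> ('b \<Rightarrow> complex) \<Rightarrow> 'b \<Rightarrow> complex"

definition is_gmodule :: "(complex^2^2) set \<Rightarrow> 'b gmod \<Rightarrow> bool" where
  "is_gmodule G M \<longleftrightarrow> cfun.subspace (gspace M) \<and>
     (\<forall>g\<in>G. gact M g ` gspace M \<subseteq> gspace M \<and> linear_on (gspace M) (gact M g)) \<and>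
     (\<forall>x\<in>gspace M. gact M (mat 1) x = x) \<and>
     (\<forall>g\<in>G. \<forall>h\<in>G. \<forall>x\<in>gspace M. gact M (g ** h) x = gact M g (gact M h x))"

definition is_submodule :: "(complex^2^2) set \<Rightarrow> 'b gmod \<Rightarrow> ('b \<Rightarrow> complex) set \<Rightarrow> bool" where
  "is_submodule G M U \<longleftrightarrow> cfun.subspace U \<and> U \<subseteq> gspace M \<and> (\<forall>g\<in>G. gact M g ` U \<subseteq> U)"

abbreviation submod :: "'b gmod \<Rightarrow> ('b \<Rightarrow> complex) set \<Rightarrow> 'b gmod" where
  "submod M U \<equiv> M\<lparr>gspace := U\<rparr>"

definition irreducible_gmod :: "(complex^2^2) set \<Rightarrow> 'b gmod \<Rightarrow> bool" where
  "irreducible_gmod G M \<longleftrightarrow> is_gmodule G M \<and> gspace M \<noteq> {0} \<and>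
     (\<forall>U. is_submodule G M U \<longrightarrow> U = {0} \<or> U = gspace M)"

definition gmod_iso :: "(complex^2^2) set \<Rightarrow> 'b gmod \<Rightarrow> 'c gmod \<Rightarrow> bool" where
  "gmod_iso G M N \<longleftrightarrow> (\<exists>f. bij_betw f (gspace M) (gspace N) \<and> linear_on (gspace M) f \<and>
     (\<forall>g\<in>G. \<forall>x\<in>gspace M. f (gact M g x) = gact N g (f x)))"

definition completely_reducible :: "(complex^2^2) set \<Rightarrow> 'b gmod \<Rightarrow> bool" where
  "completely_reducible G M \<longleftrightarrow> (\<exists>(I :: nat set) U. is_direct_sum (gspace M) I U \<and>
     (\<forall>i\<in>I. is_submodule G M (U i) \<and> irreducible_gmod G (submod M (U i))))"

definition gdim :: "'b gmod \<Rightarrow> nat" where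
  "gdim M = cfun.dim (gspace M)"

text \<open>\<open>M \<otimes> V\<close>: the function \<open>x\<close> stands for \<open>\<Sum>j. x (\<cdot>, j) \<otimes> v\<^sub>j\<close>.\<close>

definition tensor_V :: "'b gmod \<Rightarrow> ('b \<times> 2) gmod" where
  "tensor_V M = \<lparr>gspace = {x. \<forall>j. (\<lambda>b. x (b, j)) \<in> gspace M},
     gact = (\<lambda>g x (b, j). \<Sum>i\<in>UNIV. g $ j $ i * gact M g (\<lambda>b. x (b, i)) b)\<rparr>"

text \<open>\<open>X \<cong> \<Oplus>\<beta>\<in>\<Lambda>. m \<beta> \<cdot> M \<beta>\<close>\<close>

definition decomposes_as ::
  "(complex^2^2) set \<Rightarrow> 'b gmod \<Rightarrow> 'l set \<Rightarrow> ('l \<Rightarrow> 'c gmod) \<Rightarrow> ('l \<Rightarrow> nat) \<Rightarrow> bool" where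
  "decomposes_as G X \<Lambda> M m \<longleftrightarrow> (\<exists>(I :: nat set) U \<tau>. is_direct_sum (gspace X) I U \<and>
     (\<forall>i\<in>I. is_submodule G X (U i) \<and> \<tau> i \<in> \<Lambda> \<and> gmod_iso G (submod X (U i)) (M (\<tau> i))) \<and>
     (\<forall>\<beta>\<in>\<Lambda>. m \<beta> = card {i\<in>I. \<tau> i = \<beta>}))"


text \<open>
  The index \<open>1 :: 2\<close> stands for the label \<open>-1\<close> and \<open>2 :: 2\<close> for the label \<open>1\<close>. A vector
  \<open>\<Sum>p. x p v\<^sub>p\<close> is the function \<open>x\<close> on words, where \<open>V\<^sup>\<otimes>\<^sup>k\<close> consists of the functions supported on
  words of length \<open>k\<close>. An endomorphism of \<open>V\<^sup>\<otimes>\<^sup>k\<close> is its matrix (\<open>a p q\<close> has row \<open>p\<close> and column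
  \<open>q\<close>), extended by 0 to all pairs of words. The operations below sum over words of the length
  of the given word, so they need no level argument.
\<close>

type_synonym tensor = "2 list \<Rightarrow> complex"
type_synonym tmat = "2 list \<Rightarrow> 2 list \<Rightarrow> complex"

definition tapp :: "tmat \<Rightarrow> tensor \<Rightarrow> tensor" where
  "tapp a x = (\<lambda>p. \<Sum>q | length q = length p. a p q * x q)"

definition tmul :: "tmat \<Rightarrow> tmat \<Rightarrow> tmat" (infixl "\<odot>" 70) where
  "a \<odot> b = (\<lambda>p q. \<Sum>r | length r = length p. a p r * b r q)"

definition tscale :: "complex \<Rightarrow> tmat \<Rightarrow> tmat" where
  "tscale c a = (\<lambda>p q. c * a p q)"

definition diag_mat :: "complex^2^2 \<Rightarrow> tmat" where
  "diag_mat g = (\<lambda>p q. if length p = length q then \<Prod>i<length p. g $ (p ! i) $ (q ! i) else 0)"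

definition tpow :: "nat \<Rightarrow> 2 list gmod" where
  "tpow k = \<lparr>gspace = {x. \<forall>p. length p \<noteq> k \<longrightarrow> x p = 0}, gact = (\<lambda>g. tapp (diag_mat g))\<rparr>"

definition tEnd :: "nat \<Rightarrow> tmat set" where
  "tEnd k = {a. \<forall>p q. \<not> (length p = k \<and> length q = k) \<longrightarrow> a p q = 0}"

definition centralizer :: "(complex^2^2) set \<Rightarrow> nat \<Rightarrow> tmat set" where
  "centralizer G k = {a \<in> tEnd k. \<forall>g\<in>G. \<forall>x\<in>gspace (tpow k).
     tapp a (gact (tpow k) g x) = gact (tpow k) g (tapp a x)}"

definition timage :: "nat \<Rightarrow> tmat \<Rightarrow> tensor set" where
  "timage k a = tapp a ` gspace (tpow k)"

text \<open>The embedding \<open>a \<mapsto> a \<otimes> 1\<close>.\<close>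

definition temb :: "tmat \<Rightarrow> tmat" where
  "temb a = (\<lambda>p q. if p \<noteq> [] \<and> q \<noteq> [] \<and> last p = last q then a (butlast p) (butlast q) else 0)"

text \<open>For a subspace \<open>U\<close> of \<open>V\<^sup>\<otimes>\<^sup>k\<close>, the subspace \<open>U \<otimes> V\<close> of \<open>V\<^sup>\<otimes>\<^sup>(\<^sup>k\<^sup>+\<^sup>1\<^sup>)\<close>.\<close>

definition sub_tensor_V :: "tensor set \<Rightarrow> tensor set" where
  "sub_tensor_V U = {x. x [] = 0 \<and> (\<forall>j. (\<lambda>p. x (p @ [j])) \<in> U)}"

text \<open>Entry of \<open>e\<close> in row \<open>(a, b)\<close> and column \<open>(l, m)\<close>.\<close>

definition e_entry :: "2 \<Rightarrow> 2 \<Rightarrow> 2 \<Rightarrow> 2 \<Rightarrow> complex" where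
  "e_entry a b l m = of_bool (a = l \<and> b = m) - of_bool (a = m \<and> b = l)"

text \<open>
  \<open>tl_e n i\<close> is \<open>e\<^sub>i\<close> in \<open>End(V\<^sup>\<otimes>\<^sup>n)\<close>, for \<open>1 \<le> i < n\<close>. Tensor positions count from 1 but list
  positions from 0.
\<close>

definition tl_e :: "nat \<Rightarrow> nat \<Rightarrow> tmat" where
  "tl_e n i = (\<lambda>p q. if length p = n \<and> length q = n \<and>
        (\<forall>t<n. t \<noteq> i - 1 \<and> t \<noteq> i \<longrightarrow> p ! t = q ! t)
      then e_entry (p ! (i - 1)) (p ! i) (q ! (i - 1)) (q ! i) else 0)"

definition cond_exp :: "tmat \<Rightarrow> tmat" where
  "cond_exp a = (\<lambda>p q. (a (p @ [1]) (q @ [1]) + a (p @ [2]) (q @ [2])) / 2)"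


definition is_irrep_system :: "(complex^2^2) set \<Rightarrow> 'l set \<Rightarrow> ('l \<Rightarrow> 'b gmod) \<Rightarrow> bool" where
  "is_irrep_system G \<Lambda> M \<longleftrightarrow>
     (\<forall>\<alpha>\<in>\<Lambda>. irreducible_gmod G (M \<alpha>) \<and>
        (\<exists>k U. is_submodule G (tpow k) U \<and> gmod_iso G (submod (tpow k) U) (M \<alpha>))) \<and>
     (\<forall>\<alpha>\<in>\<Lambda>. \<forall>\<beta>\<in>\<Lambda>. gmod_iso G (M \<alpha>) (M \<beta>) \<longrightarrow> \<alpha> = \<beta>) \<and>
     (\<forall>k U. is_submodule G (tpow k) U \<and> irreducible_gmod G (submod (tpow k) U) \<longrightarrow>
        (\<exists>\<alpha>\<in>\<Lambda>. gmod_iso G (submod (tpow k) U) (M \<alpha>)))"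

text \<open>The level is an integer so that \<open>\<Lambda>\<^sub>j(G)\<close> is empty for negative \<open>j\<close>.\<close>

definition Lev :: "(complex^2^2) set \<Rightarrow> 'l set \<Rightarrow> ('l \<Rightarrow> 'b gmod) \<Rightarrow> int \<Rightarrow> 'l set" where
  "Lev G \<Lambda> M j = {\<alpha>\<in>\<Lambda>. j \<ge> 0 \<and>
     (\<exists>U. is_submodule G (tpow (nat j)) U \<and> gmod_iso G (submod (tpow (nat j)) U) (M \<alpha>))}"

definition isotypic :: "(complex^2^2) set \<Rightarrow> nat \<Rightarrow> 'b gmod \<Rightarrow> tensor set" where
  "isotypic G k N =
     cfun.span (\<Union>{U. is_submodule G (tpow k) U \<and> gmod_iso G (submod (tpow k) U) N})"

definition V_new :: "(complex^2^2) set \<Rightarrow> 'l set \<Rightarrow> ('l \<Rightarrow> 'b gmod) \<Rightarrow> nat \<Rightarrow> tensor set" where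
  "V_new G \<Lambda> M k =
     cfun.span (\<Union>\<alpha>\<in>Lev G \<Lambda> M (int k) - Lev G \<Lambda> M (int k - 2). isotypic G k (M \<alpha>))"

text \<open>
  The standing assumption on \<open>M \<alpha> \<otimes> V \<cong> \<Oplus>\<beta>. a \<alpha> \<beta> \<cdot> M \<beta>\<close>; the label 0 is the one of the
  trivial module \<open>V\<^sup>\<otimes>\<^sup>0\<close>.
\<close>

definition admissible_rule ::
  "(complex^2^2) set \<Rightarrow> 'l set \<Rightarrow> ('l \<Rightarrow> 'b gmod) \<Rightarrow> ('l \<Rightarrow> 'l \<Rightarrow> nat) \<Rightarrow> bool" where
  "admissible_rule G \<Lambda> M a \<longleftrightarrow>
     (\<forall>\<alpha>\<in>\<Lambda>. decomposes_as G (tensor_V (M \<alpha>)) \<Lambda> M (a \<alpha>)) \<and>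
     (\<forall>\<alpha>\<in>\<Lambda>. \<forall>\<beta>\<in>\<Lambda>. a \<alpha> \<beta> = a \<beta> \<alpha> \<and> a \<alpha> \<beta> \<in> {0, 1}) \<and>
     (\<forall>\<alpha>\<in>\<Lambda>. \<not> gmod_iso G (M \<alpha>) (tpow 0) \<longrightarrow> a \<alpha> \<alpha> = 0)"

text \<open>\<open>f\<close> is an idempotent of \<open>Z\<^sub>k\<close> with image \<open>U\<close>, a copy of the module \<open>N\<close>.\<close>

definition projects_onto ::
  "(complex^2^2) set \<Rightarrow> nat \<Rightarrow> tmat \<Rightarrow> tensor set \<Rightarrow> 'b gmod \<Rightarrow> bool" where
  "projects_onto G k f U N \<longleftrightarrow> f \<in> centralizer G k \<and> f \<odot> f = f \<and> timage k f = U \<and>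
     gmod_iso G (submod (tpow k) U) N"

end

theory Submission
  imports Defs "HOL-Computational_Algebra.Fundamental_Theorem_Algebra"
begin

text \<open>
  Let \<open>w = v\<^sub>-\<^sub>1 \<otimes> v\<^sub>1 - v\<^sub>1 \<otimes> v\<^sub>-\<^sub>1\<close> be the antisymmetric tensor. Up to the isomorphism of \<open>\<complex>\<close> with
  the line of \<open>w\<close>, the map \<open>e\<close> is the alternating form on \<open>V\<close>: \<open>e\<close> at the last two positions
  factors as \<open>cup \<circ> cap\<close>, where \<open>cap\<close> contracts these positions and \<open>cup\<close> appends \<open>w\<close>
  (\<open>tl_e_eq_cup_cap\<close>). Both maps commute with the group since its elements have determinant 1. For
  an endomorphism \<open>a\<close> of \<open>V\<^sup>\<otimes>\<^sup>(\<^sup>n\<^sup>+\<^sup>1\<^sup>)\<close> one has \<open>cap \<circ> (a \<otimes> 1) \<circ> cup = 2 \<epsilon>(a)\<close>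
  (\<open>tapp_cond_exp\<close>), whence \<open>e\<^sub>n\<^sub>+\<^sub>1 a e\<^sub>n\<^sub>+\<^sub>1 = 2 \<epsilon>(a) e\<^sub>n\<^sub>+\<^sub>1\<close> (\<open>tl_e_sandwich\<close>).

  The heart of the proof is that \<open>2 \<epsilon>(f\<^sub>\<mu>)\<close> acts on the given copy of \<open>G\<^sup>\<lambda>\<close> as the scalar
  \<open>c = d\<^sup>\<mu> / d\<^sup>\<lambda>\<close> (\<open>cond_exp_idempotent_scalar\<close>): it is an intertwiner with image in that copy,
  so Schur's lemma gives a scalar, and its trace, which is the trace of \<open>f\<^sub>\<mu>\<close>, determines the scalar.
  A vector in the image of \<open>f\<^sub>\<mu>\<close> at level \<open>k + 2\<close> is contracted into this copy, so
  \<open>X = f\<^sub>\<mu> e\<^sub>k\<^sub>+\<^sub>1 f\<^sub>\<mu>\<close> satisfies \<open>X\<^sup>2 = c X\<close>. Hence \<open>X / c\<close> is an idempotent below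
  \<open>f\<^sub>\<mu>\<close>, and \<open>f\<^sub>\<nu>\<close> is its complement in \<open>f\<^sub>\<mu>\<close>; this is (i) and (ii). Statement (iii) is the
  locality of the operators (\<open>tl_e_commute\<close>).

  For (iv), \<open>\<epsilon>\<close> is a bimodule map and \<open>\<epsilon>(e\<^sub>k\<^sub>+\<^sub>1)\<close> is half of the identity, so
  \<open>\<epsilon>(f\<^sub>\<nu>) = (1 - d\<^sup>\<lambda> / (2 d\<^sup>\<mu>)) f\<^sub>\<mu>\<close>, and \<open>2 d\<^sup>\<mu> = d\<^sup>\<lambda> + d\<^sup>\<nu>\<close>. The other equation of (iv)
  is \<open>tl_e_sandwich\<close>.

  For (v), the contraction maps the copy of \<open>G\<^sup>\<nu>\<close> to \<open>V\<^sup>\<otimes>\<^sup>k\<close>, where \<open>\<nu>\<close> does not occur; so it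
  vanishes there (\<open>cap_vanishes\<close>), \<open>e\<^sub>k\<^sub>+\<^sub>1\<close> kills this copy, and \<open>f\<^sub>\<nu>\<close> fixes it. The image of
  \<open>f\<^sub>\<nu>\<close> is not larger, because its dimension is the trace \<open>2 tr \<epsilon>(f\<^sub>\<nu>) = d\<^sup>\<nu>\<close>.

  In the code, \<open>\<alpha>\<close> is the label \<open>\<lambda>\<close>, the embedding \<open>a \<mapsto> a \<otimes> 1\<close> is \<open>temb\<close>, and \<open>\<epsilon>\<close> is
  \<open>cond_exp\<close>.
\<close>

section \<open>Linear maps between spaces of functions\<close>

lemma sum_fun_apply: "(\<Sum>i\<in>A. F i) b = (\<Sum>i\<in>A. F i b)" for F :: "'i \<Rightarrow> 'b \<Rightarrow> complex"
  by (induction A rule: infinite_finite_induct) auto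

lemma linear_on_zero:
  assumes "linear_on X f" "cfun.subspace X"
  shows "f 0 = 0"
proof -
  have "f (cscale 0 0) = cscale 0 (f 0)"
    using assms cfun.subspace_0 unfolding linear_on_def by blast
  then show ?thesis by simp
qed

lemma linear_on_sum:
  assumes f: "linear_on X f" and X: "cfun.subspace X" and B: "\<And>v. v \<in> B \<Longrightarrow> h v \<in> X"
  shows "f (\<Sum>v\<in>B. cscale (u v) (h v)) = (\<Sum>v\<in>B. cscale (u v) (f (h v)))"
  using B
proof (induction B rule: infinite_finite_induct)
  case (insert v B)
  have "cscale (u v) (h v) \<in> X" "(\<Sum>v\<in>B. cscale (u v) (h v)) \<in> X"
    using insert.prems by (auto intro!: cfun.subspace_scale[OF X] cfun.subspace_sum[OF X])
  then have "f (cscale (u v) (h v) + (\<Sum>v\<in>B. cscale (u v) (h v)))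
      = cscale (u v) (f (h v)) + f (\<Sum>v\<in>B. cscale (u v) (h v))"
    using f insert.prems unfolding linear_on_def by (metis insertI1)
  then show ?case unfolding sum.insert[OF insert.hyps] using insert.IH insert.prems by (metis insertI2)
next
  case (infinite A)
  then show ?case unfolding sum.infinite[OF infinite.hyps] by (intro linear_on_zero[OF f X])
next
  case empty
  show ?case unfolding sum.empty by (rule linear_on_zero[OF f X])
qed

text \<open>
  The maps of the module isomorphisms are linear only on a subspace, which is why a basis has to
  be transported by hand.
\<close>

lemma dim_linear_bij:
  assumes f: "linear_on X f" and X: "cfun.subspace X" and b: "bij_betw f X Y"
    and S: "finite S" "X \<subseteq> cfun.span S"
  shows "cfun.dim Y = cfun.dim X"
proof -
  obtain B where B: "B \<subseteq> X" "cfun.independent B" "X \<subseteq> cfun.span B" "card B = cfun.dim X"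
    using cfun.basis_exists .
  have fB: "finite B" using cfun.independent_span_bound[OF S(1) B(2)] B(1) S(2) by blast
  have inj: "inj_on f X" and Y: "Y = f ` X" using b by (auto simp: bij_betw_def)
  have injB: "inj_on f B" using inj B(1) inj_on_subset by blast
  have lin: "f (\<Sum>v\<in>B. cscale (u v) v) = (\<Sum>v\<in>B. cscale (u v) (f v))" for u
    using linear_on_sum[OF f X, of B "\<lambda>v. v" u] B(1) by auto
  have sumX: "(\<Sum>v\<in>B. cscale (u v) v) \<in> X" for u
    using B(1) by (auto intro!: cfun.subspace_sum[OF X] cfun.subspace_scale[OF X])
  have "cfun.independent (f ` B)"
  proof (rule cfun.independent_if_scalars_zero)
    fix u y assume s: "(\<Sum>x\<in>f ` B. cscale (u x) x) = 0" and y: "y \<in> f ` B"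
    then obtain v where v: "v \<in> B" "y = f v" by auto
    have "f (\<Sum>v\<in>B. cscale (u (f v)) v) = f 0"
      using s lin linear_on_zero[OF f X] by (simp add: sum.reindex[OF injB] o_def)
    then have "(\<Sum>v\<in>B. cscale (u (f v)) v) = 0"
      using inj sumX cfun.subspace_0[OF X] by (auto dest: inj_onD)
    then show "u y = 0" using cfun.independentD[OF B(2) fB order_refl] v by auto
  qed (use fB in auto)
  moreover have "Y \<subseteq> cfun.span (f ` B)"
  proof
    fix y assume "y \<in> Y"
    then obtain x where x: "x \<in> X" "y = f x" using Y by auto
    then obtain u where "x = (\<Sum>v\<in>B. cscale (u v) v)"
      using B(3) cfun.span_finite[OF fB] by auto
    then have y: "y = (\<Sum>v\<in>B. cscale (u v) (f v))" using x lin by simp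
    show "y \<in> cfun.span (f ` B)"
      unfolding y by (intro cfun.span_sum cfun.span_scale cfun.span_base) simp
  qed
  moreover have "f ` B \<subseteq> Y" using B(1) Y by blast
  moreover have "card (f ` B) = cfun.dim X" using B(4) card_image[OF injB] by metis
  ultimately show ?thesis using cfun.dim_unique by metis
qed

lemma dim_direct_sum_2:
  assumes ds: "is_direct_sum W {\<alpha>, \<nu>} U" and ne: "\<alpha> \<noteq> \<nu>" and W: "cfun.subspace W"
    and S: "finite S" "W \<subseteq> cfun.span S"
  shows "cfun.dim W = cfun.dim (U \<alpha>) + cfun.dim (U \<nu>)"
proof -
  have sub: "cfun.subspace (U \<alpha>)" "U \<alpha> \<subseteq> W" "cfun.subspace (U \<nu>)" "U \<nu> \<subseteq> W"
    and ex: "\<And>x. x \<in> W \<Longrightarrow> \<exists>!u. (\<forall>i\<in>{\<alpha>, \<nu>}. u i \<in> U i) \<and> (\<forall>i. i \<notin> {\<alpha>, \<nu>} \<longrightarrow> u i = 0) \<and> x = (\<Sum>i\<in>{\<alpha>, \<nu>}. u i)"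
    using ds unfolding is_direct_sum_def by auto
  have int: "x = 0" if "x \<in> U \<alpha>" "x \<in> U \<nu>" for x
  proof -
    let ?u = "\<lambda>i. if i = \<alpha> then x else 0" and ?v = "\<lambda>i. if i = \<nu> then x else 0"
    have "x \<in> W" using that sub by auto
    define Q where "Q u \<longleftrightarrow> (\<forall>i\<in>{\<alpha>, \<nu>}. u i \<in> U i) \<and> (\<forall>i. i \<notin> {\<alpha>, \<nu>} \<longrightarrow> u i = 0) \<and> x = (\<Sum>i\<in>{\<alpha>, \<nu>}. u i)" for u
    have "\<exists>!u. Q u" using ex[OF \<open>x \<in> W\<close>] unfolding Q_def .
    moreover have "Q ?u" "Q ?v"
      unfolding Q_def using that ne cfun.subspace_0[OF sub(1)] cfun.subspace_0[OF sub(3)] by auto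
    ultimately have "?u = ?v" by blast
    from fun_cong[OF this, of \<alpha>] show "x = 0" using ne by simp
  qed
  obtain A where A: "A \<subseteq> U \<alpha>" "cfun.independent A" "U \<alpha> \<subseteq> cfun.span A" "card A = cfun.dim (U \<alpha>)"
    using cfun.basis_exists .
  obtain B where B: "B \<subseteq> U \<nu>" "cfun.independent B" "U \<nu> \<subseteq> cfun.span B" "card B = cfun.dim (U \<nu>)"
    using cfun.basis_exists .
  have fin: "finite A" "finite B"
    using cfun.independent_span_bound[OF S(1)] A B sub S(2) by (meson order_trans)+
  have disj: "A \<inter> B = {}"
    using int A(1,2) B(1) cfun.dependent_zero by blast
  have "cfun.independent (A \<union> B)"
  proof (rule cfun.independent_if_scalars_zero)
    fix u y assume s: "(\<Sum>x\<in>A \<union> B. cscale (u x) x) = 0" and y: "y \<in> A \<union> B"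
    let ?a = "\<Sum>x\<in>A. cscale (u x) x" and ?b = "\<Sum>x\<in>B. cscale (u x) x"
    have ab: "?a + ?b = 0" using s fin disj by (simp add: sum.union_disjoint)
    have a: "?a \<in> U \<alpha>" using A(1) by (auto intro!: cfun.subspace_sum cfun.subspace_scale sub)
    have b: "?b \<in> U \<nu>" using B(1) by (auto intro!: cfun.subspace_sum cfun.subspace_scale sub)
    have "?a = - ?b" using ab by (simp add: eq_neg_iff_add_eq_0)
    then have "?a \<in> U \<nu>" using cfun.subspace_neg[OF sub(3) b] by simp
    then have "?a = 0" "?b = 0" using int[OF a] ab by auto
    then show "u y = 0"
      using y cfun.independentD[OF A(2) fin(1) order_refl] cfun.independentD[OF B(2) fin(2) order_refl] by auto
  qed (use fin in auto)
  moreover have "W \<subseteq> cfun.span (A \<union> B)"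
  proof
    fix x assume "x \<in> W"
    from ex1_implies_ex[OF ex[OF this]] obtain u where "u \<alpha> \<in> U \<alpha>" "u \<nu> \<in> U \<nu>" "x = u \<alpha> + u \<nu>" using ne by auto
    then show "x \<in> cfun.span (A \<union> B)" using A(3) B(3) unfolding cfun.span_Un by blast
  qed
  moreover have "A \<union> B \<subseteq> W" using A(1) B(1) sub by auto
  ultimately show ?thesis
    using cfun.dim_unique A(4) B(4) card_Un_disjoint[OF fin disj] by metis
qed

lemma subspace_eq_of_dim_le:
  assumes "cfun.subspace X" "X \<subseteq> Y" "cfun.dim Y \<le> cfun.dim X" "finite S" "Y \<subseteq> cfun.span S"
  shows "X = Y"
proof -
  obtain B where B: "B \<subseteq> X" "cfun.independent B" "X \<subseteq> cfun.span B" "card B = cfun.dim X"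
    using cfun.basis_exists .
  obtain C where C: "B \<subseteq> C" "C \<subseteq> Y" "cfun.independent C" "Y \<subseteq> cfun.span C"
    using cfun.maximal_independent_subset_extend[of B Y] B assms(2) by (metis order_trans)
  have "finite C" using cfun.independent_span_bound[OF assms(4) C(3)] C(2) assms(5) by blast
  moreover have "card C = cfun.dim Y" using cfun.dim_unique C by metis
  ultimately have "B = C" using C(1) B(4) assms(3) by (metis card_seteq)
  then show ?thesis using C(4) B(1) cfun.span_minimal[OF B(1) assms(1)] assms(2) by auto
qed

text \<open>
  The powers of \<open>h\<close> applied to \<open>x\<close> cannot be independent, so a nonzero polynomial in \<open>h\<close> kills
  \<open>x\<close>; peeling off its complex linear factors one at a time, some factor must kill a nonzero
  vector.
\<close>

lemma eigenvector_exists: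
  assumes add: "\<And>x y. h (x + y) = h x + h y" and sc: "\<And>c x. h (cscale c x) = cscale c (h x)"
    and X: "cfun.subspace X" "X \<noteq> {0}" and hX: "\<And>x. x \<in> X \<Longrightarrow> h x \<in> X"
    and S: "finite S" "X \<subseteq> cfun.span S"
  shows "\<exists>c. \<exists>x\<in>X. x \<noteq> 0 \<and> h x = cscale c x"
proof -
  define act where "act P x = (\<Sum>i\<le>degree P. cscale (coeff P i) ((h ^^ i) x))" for P x
  have act_le: "act P x = (\<Sum>i\<le>n. cscale (coeff P i) ((h ^^ i) x))" if "degree P \<le> n" for P x n
    unfolding act_def by (rule sum.mono_neutral_left) (use that coeff_eq_0[of P] in auto)
  have pow_add: "(h ^^ i) (x + y) = (h ^^ i) x + (h ^^ i) y" for i x y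
    by (induction i) (simp_all only: funpow.simps o_apply id_apply add)
  have pow_sc: "(h ^^ i) (cscale c x) = cscale c ((h ^^ i) x)" for i c x
    by (induction i) (simp_all only: funpow.simps o_apply id_apply sc)
  have factor: "act ([:- z, 1:] * Q) x = act Q (h x + cscale (- z) x)" for z Q x
  proof -
    let ?n = "Suc (degree Q)"
    have "degree ([:- z, 1:] * Q) \<le> ?n"
      by (rule order_trans[OF degree_mult_le]) auto
    then have "act ([:- z, 1:] * Q) x
      = (\<Sum>i\<le>?n. cscale (coeff (pCons 0 Q) i) ((h ^^ i) x) + cscale (- z) (cscale (coeff Q i) ((h ^^ i) x)))"
      by (simp add: act_le) (auto intro!: sum.cong simp: cfun.scale_left_distrib cfun.scale_left_diff_distrib)
    also have "\<dots> = (\<Sum>i\<le>?n. cscale (coeff (pCons 0 Q) i) ((h ^^ i) x)) + cscale (- z) (act Q x)"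
      unfolding sum.distrib by (simp only: act_le[of Q ?n x] cfun.scale_sum_right le_SucI[OF order_refl])
    also have "(\<Sum>i\<le>?n. cscale (coeff (pCons 0 Q) i) ((h ^^ i) x)) = act Q (h x)"
      unfolding sum.atMost_Suc_shift by (simp add: act_def funpow_swap1)
    also have "cscale (- z) (act Q x) = act Q (cscale (- z) x)"
      unfolding act_def by (simp only: cfun.scale_sum_right pow_sc cfun.scale_scale mult.commute)
    also have "act Q (h x) + act Q (cscale (- z) x) = act Q (h x + cscale (- z) x)"
      unfolding act_def by (simp only: pow_add cfun.scale_right_distrib sum.distrib)
    finally show ?thesis .
  qed
  have main: "\<exists>c. \<exists>x\<in>X. x \<noteq> 0 \<and> h x = cscale c x"
    if "P \<noteq> 0" "x \<in> X" "x \<noteq> 0" "act P x = 0" for P x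
    using that
  proof (induction "degree P" arbitrary: P x)
    case 0
    then obtain c where "P = [:c:]" "c \<noteq> 0" by (metis degree_eq_zeroE pCons_eq_0_iff)
    moreover have "act [:c:] x = cscale c x" by (simp add: act_def)
    ultimately have "cscale c x = 0" using \<open>act P x = 0\<close> by metis
    then show ?case using \<open>c \<noteq> 0\<close> \<open>x \<noteq> 0\<close> cfun.scale_eq_0_iff by metis
  next
    case (Suc n)
    have "\<not> constant (poly P)" using Suc.hyps(2) constant_degree[of P] by simp
    then obtain z where "poly P z = 0" using fundamental_theorem_of_algebra by blast
    then obtain Q where Q: "P = [:- z, 1:] * Q"
      unfolding poly_eq_0_iff_dvd by (elim dvdE)
    then have "Q \<noteq> 0" using Suc.prems(1) by (metis mult_zero_right)
    let ?y = "h x + cscale (- z) x"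
    have yX: "?y \<in> X" by (intro cfun.subspace_add cfun.subspace_scale X hX Suc.prems)
    have deg: "n = degree Q"
      using Suc.hyps(2) \<open>Q \<noteq> 0\<close> unfolding Q by (subst (asm) degree_mult_eq) auto
    show ?case
    proof (cases "?y = 0")
      case True
      then have "h x = cscale z x" unfolding cfun.scale_minus_left by (simp only: eq_neg_iff_add_eq_0[symmetric] minus_minus)
      then show ?thesis using Suc.prems by blast
    next
      case False
      then show ?thesis using Suc.hyps(1)[OF deg \<open>Q \<noteq> 0\<close> yX] Suc.prems Q factor by metis
    qed
  qed
  obtain x where x: "x \<in> X" "x \<noteq> 0" using X cfun.subspace_0 by blast
  have powX: "(h ^^ i) x \<in> X" for i by (induction i) (auto simp: x hX)
  let ?v = "\<lambda>i. (h ^^ i) x"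
  show ?thesis
  proof (cases "inj ?v")
    case False
    then obtain i j where ij: "i \<noteq> j" "?v i = ?v j" by (auto simp: inj_def)
    let ?P = "monom (1::complex) i - monom 1 j"
    have "?P \<noteq> 0" using ij(1) by (simp add: monom_eq_iff')
    moreover have "degree ?P \<le> i + j"
      by (rule order_trans[OF degree_diff_le_max]) (auto simp: degree_monom_eq)
    then have "act ?P x = (\<Sum>l\<le>i + j. cscale (if l = i then 1 else 0) (?v l)) - (\<Sum>l\<le>i + j. cscale (if l = j then 1 else 0) (?v l))"
      by (simp only: act_le sum_subtractf[symmetric])
         (auto intro!: sum.cong simp: cfun.scale_left_diff_distrib)
    then have "act ?P x = 0"
      using ij(2) by (simp add: if_distrib[of "\<lambda>c. cscale c _"] sum.delta cong: if_cong)
    ultimately show ?thesis using main[OF _ x] by blast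
  next
    case True
    let ?N = "card S"
    have inj: "inj_on ?v {..?N}" using True by (rule inj_on_subset) auto
    have "cfun.dependent (?v ` {..?N})"
    proof (rule ccontr)
      assume "\<not> ?thesis"
      then have "card (?v ` {..?N}) \<le> card S"
        using cfun.independent_span_bound[OF S(1)] powX S(2) by blast
      then show False using card_image[OF inj] by simp
    qed
    then obtain u w where u: "w \<in> ?v ` {..?N}" "u w \<noteq> 0" "(\<Sum>v\<in>?v ` {..?N}. cscale (u v) v) = 0"
      using cfun.dependent_finite[of "?v ` {..?N}"] by auto
    define P where "P = (\<Sum>i\<le>?N. monom (u (?v i)) i)"
    have cP: "coeff P i = (if i \<le> ?N then u (?v i) else 0)" for i
      by (simp add: P_def coeff_sum)
    obtain l where "l \<le> ?N" "w = ?v l" using u(1) by auto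
    then have "coeff P l \<noteq> 0" using u(2) cP by simp
    then have "P \<noteq> 0" by (metis coeff_0)
    moreover have "degree P \<le> ?N" using cP by (auto intro!: degree_le)
    then have "act P x = 0"
      using u(3) by (simp add: act_le sum.reindex[OF inj] o_def cP)
    ultimately show ?thesis using main[OF _ x] by blast
  qed
qed

section \<open>Matrices acting on tensors\<close>

lemma finite_words: "finite {q :: 2 list. length q = n}"
  using finite_lists_length_eq[of "UNIV :: 2 set" n] by simp

lemma sum_words_Suc:
  "(\<Sum>q :: 2 list | length q = Suc n. h q) = (\<Sum>q | length q = n. h (q @ [1]) + h (q @ [2]))"
proof -
  have *: "bij_betw (\<lambda>(q, j). q @ [j]) ({q :: 2 list. length q = n} \<times> UNIV) {q. length q = Suc n}"
  proof (rule bij_betwI[where g = "\<lambda>q. (butlast q, last q)"])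
    show "(\<lambda>q. (butlast q, last q)) \<in> {q :: 2 list. length q = Suc n} \<rightarrow> {q. length q = n} \<times> UNIV"
      by auto
    show "(case (butlast q, last q) of (r, j) \<Rightarrow> r @ [j]) = q" if "q \<in> {q :: 2 list. length q = Suc n}" for q
      using that by (cases q rule: rev_cases) auto
  qed auto
  have "(\<Sum>q :: 2 list | length q = Suc n. h q) = (\<Sum>(q, j) \<in> {q. length q = n} \<times> UNIV. h (q @ [j]))"
    using sum.reindex_bij_betw[OF *, of h] by (simp add: case_prod_unfold)
  also have "\<dots> = (\<Sum>q | length q = n. \<Sum>j\<in>UNIV. h (q @ [j]))"
    by (rule sum.cartesian_product[symmetric])
  finally show ?thesis by (simp add: sum_2)
qed

lemma sum_words_delta:
  "(\<Sum>q :: 2 list | length q = n. (if q = r then h q else 0)) = (if length r = n then h r else 0)"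
  using finite_words[of n] by (simp add: sum.delta')

lemma two_letters_cases:
  obtains "p = []" | i where "p = [i]" | q i j where "p = q @ [i, j]"
  by (metis append.assoc append_Cons append_Nil rev_exhaust)

lemma mem_tpow: "x \<in> gspace (tpow n) \<longleftrightarrow> (\<forall>p. length p \<noteq> n \<longrightarrow> x p = 0)"
  by (simp add: tpow_def)

lemma gact_tpow: "gact (tpow n) g = tapp (diag_mat g)"
  by (simp add: tpow_def)

lemma subspace_tpow: "cfun.subspace (gspace (tpow n))"
  by (auto simp: cfun.subspace_def mem_tpow cscale_def)

lemma tapp_add: "tapp a (x + y) = tapp a x + tapp a y"
  by (simp add: tapp_def fun_eq_iff distrib_left sum.distrib)

lemma tapp_cscale: "tapp a (cscale c x) = cscale c (tapp a x)"
  by (simp add: tapp_def cscale_def sum_distrib_left mult.left_commute)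

lemma tapp_zero: "tapp a 0 = 0"
  by (simp add: tapp_def fun_eq_iff)

lemma tapp_minus: "tapp a (x - y) = tapp a x - tapp a y"
  by (simp add: tapp_def fun_eq_iff right_diff_distrib sum_subtractf)

lemma tapp_diff_mat: "tapp (a - b) x = tapp a x - tapp b x"
  by (simp add: tapp_def fun_eq_iff left_diff_distrib sum_subtractf)

lemma tapp_tscale: "tapp (tscale c a) x = cscale c (tapp a x)"
  by (simp add: tapp_def tscale_def cscale_def sum_distrib_left mult.assoc)

lemma tapp_tmul: "tapp (a \<odot> b) x = tapp a (tapp b x)"
proof
  fix p
  have "tapp (a \<odot> b) x p = (\<Sum>q | length q = length p. \<Sum>r | length r = length p. a p r * (b r q * x q))"
    by (simp add: tapp_def tmul_def sum_distrib_right mult.assoc)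
  also have "\<dots> = (\<Sum>r | length r = length p. \<Sum>q | length q = length p. a p r * (b r q * x q))"
    by (rule sum.swap)
  also have "\<dots> = tapp a (tapp b x) p"
    by (auto simp: tapp_def sum_distrib_left intro!: sum.cong)
  finally show "tapp (a \<odot> b) x p = tapp a (tapp b x) p" .
qed

lemma linear_on_tapp: "linear_on X (tapp a)"
  by (simp add: linear_on_def tapp_add tapp_cscale)

lemma tapp_cong: "(\<And>q. length q = length p \<Longrightarrow> x q = y q) \<Longrightarrow> tapp a x p = tapp a y p"
  by (auto simp: tapp_def intro!: sum.cong)

lemma tapp_in_tpow: "a \<in> tEnd n \<Longrightarrow> tapp a x \<in> gspace (tpow n)"
  by (auto simp: mem_tpow tapp_def tEnd_def intro!: sum.neutral)

lemma tapp_diag_mat_in_tpow: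
  assumes "x \<in> gspace (tpow n)"
  shows "tapp (diag_mat g) x \<in> gspace (tpow n)"
proof -
  have "tapp (diag_mat g) x p = 0" if "length p \<noteq> n" for p
    using tapp_cong[of p x 0 "diag_mat g"] that assms by (simp add: mem_tpow tapp_zero)
  then show ?thesis by (simp add: mem_tpow)
qed

definition unit_tensor :: "2 list \<Rightarrow> tensor" where
  "unit_tensor q = (\<lambda>p. of_bool (p = q))"

lemma unit_tensor_in_tpow: "unit_tensor q \<in> gspace (tpow (length q))"
  by (auto simp: mem_tpow unit_tensor_def)

lemma tapp_unit_tensor: "tapp a (unit_tensor q) p = (if length q = length p then a p q else 0)"
proof -
  have "tapp a (unit_tensor q) p = (\<Sum>r | length r = length p. (if r = q then a p r else 0))"
    by (auto simp: tapp_def unit_tensor_def intro!: sum.cong)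
  then show ?thesis by (simp add: sum_words_delta)
qed

lemma tensor_expansion:
  assumes "x \<in> gspace (tpow n)"
  shows "x = (\<Sum>q | length q = n. cscale (x q) (unit_tensor q))"
proof
  fix p
  have "(\<Sum>q | length q = n. cscale (x q) (unit_tensor q)) p = (\<Sum>q | length q = n. (if q = p then x q else 0))"
    by (auto simp: sum_fun_apply cscale_def unit_tensor_def intro!: sum.cong)
  then show "x p = (\<Sum>q | length q = n. cscale (x q) (unit_tensor q)) p"
    using assms by (simp add: sum_words_delta mem_tpow)
qed

lemma tpow_subset_span: "gspace (tpow n) \<subseteq> cfun.span (unit_tensor ` {q. length q = n})"
proof
  fix x :: tensor assume "x \<in> gspace (tpow n)"
  then have x: "x = (\<Sum>q | length q = n. cscale (x q) (unit_tensor q))" by (rule tensor_expansion)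
  show "x \<in> cfun.span (unit_tensor ` {q. length q = n})"
    by (subst x) (intro cfun.span_sum cfun.span_scale cfun.span_base, simp)
qed

text \<open>
  Identities between endomorphisms are proved by evaluating them on tensors, where \<open>cap\<close> and
  \<open>cup\<close> below are available.
\<close>

lemma tmat_eqI:
  assumes "a \<in> tEnd n" "b \<in> tEnd n" "\<And>x. x \<in> gspace (tpow n) \<Longrightarrow> tapp a x = tapp b x"
  shows "a = b"
proof (intro ext)
  fix p q
  show "a p q = b p q"
  proof (cases "length p = n \<and> length q = n")
    case True
    then show ?thesis
      using assms(3)[of "unit_tensor q"] unit_tensor_in_tpow[of q]
        tapp_unit_tensor[of a q p] tapp_unit_tensor[of b q p] by auto
  next
    case False
    then show ?thesis using assms(1,2) unfolding tEnd_def by auto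
  qed
qed

lemma tmul_assoc: "(a \<odot> b) \<odot> c = a \<odot> (b \<odot> c)"
proof (intro ext)
  fix p q
  have "((a \<odot> b) \<odot> c) p q = (\<Sum>r | length r = length p. \<Sum>s | length s = length p. a p s * (b s r * c r q))"
    by (simp add: tmul_def sum_distrib_right mult.assoc)
  also have "\<dots> = (\<Sum>s | length s = length p. \<Sum>r | length r = length p. a p s * (b s r * c r q))"
    by (rule sum.swap)
  also have "\<dots> = (a \<odot> (b \<odot> c)) p q"
    by (auto simp: tmul_def sum_distrib_left intro!: sum.cong)
  finally show "((a \<odot> b) \<odot> c) p q = (a \<odot> (b \<odot> c)) p q" .
qed

lemma tmul_diff_left: "(a - b) \<odot> c = a \<odot> c - b \<odot> c"
  by (simp add: tmul_def fun_eq_iff left_diff_distrib sum_subtractf)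

lemma tmul_diff_right: "a \<odot> (b - c) = a \<odot> b - a \<odot> c"
  by (simp add: tmul_def fun_eq_iff right_diff_distrib sum_subtractf)

lemma tmul_tscale_left: "tscale c a \<odot> b = tscale c (a \<odot> b)"
  by (simp add: tmul_def tscale_def sum_distrib_left mult.assoc)

lemma tmul_tscale_right: "a \<odot> tscale c b = tscale c (a \<odot> b)"
  by (simp add: tmul_def tscale_def sum_distrib_left mult.left_commute)

lemma tEnd_tmul: "a \<in> tEnd n \<Longrightarrow> b \<in> tEnd n \<Longrightarrow> a \<odot> b \<in> tEnd n"
  by (auto simp: tEnd_def tmul_def intro!: sum.neutral)

lemma tEnd_diff: "a \<in> tEnd n \<Longrightarrow> b \<in> tEnd n \<Longrightarrow> a - b \<in> tEnd n"
  by (auto simp: tEnd_def)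

lemma tEnd_tscale: "a \<in> tEnd n \<Longrightarrow> tscale c a \<in> tEnd n"
  by (auto simp: tEnd_def tscale_def)

lemma tEnd_temb: "a \<in> tEnd n \<Longrightarrow> temb a \<in> tEnd (Suc n)"
proof -
  assume a: "a \<in> tEnd n"
  have "temb a p q = 0" if "\<not> (length p = Suc n \<and> length q = Suc n)" for p q
    using a that by (cases p rule: rev_cases; cases q rule: rev_cases) (auto simp: temb_def tEnd_def)
  then show ?thesis by (simp add: tEnd_def)
qed

lemma tEnd_tl_e: "tl_e n i \<in> tEnd n"
  by (auto simp: tEnd_def tl_e_def)

lemma tEnd_cond_exp: "a \<in> tEnd (Suc n) \<Longrightarrow> cond_exp a \<in> tEnd n"
  by (auto simp: tEnd_def cond_exp_def)

lemma temb_snoc: "temb a (p @ [i]) (q @ [j]) = (if i = j then a p q else 0)"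
  by (simp add: temb_def)

lemma temb_Nil: "temb a [] q = 0" "temb a p [] = 0"
  by (simp_all add: temb_def)

text \<open>The coefficient of \<open>v\<^sub>j\<close> in the last tensor position.\<close>

definition slice :: "2 \<Rightarrow> tensor \<Rightarrow> tensor" where
  "slice j x = (\<lambda>p. x (p @ [j]))"

lemma slice_in_tpow: "x \<in> gspace (tpow (Suc n)) \<Longrightarrow> slice j x \<in> gspace (tpow n)"
  by (simp add: mem_tpow slice_def)

lemma tapp_snoc: "tapp a x (p @ [j])
    = (\<Sum>q | length q = length p. a (p @ [j]) (q @ [1]) * x (q @ [1]) + a (p @ [j]) (q @ [2]) * x (q @ [2]))"
  by (simp add: tapp_def sum_words_Suc)

lemma slice_tapp_temb: "slice j (tapp (temb a) x) = tapp a (slice j x)"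
proof
  fix p
  show "slice j (tapp (temb a) x) p = tapp a (slice j x) p"
    unfolding slice_def tapp_snoc temb_snoc using exhaust_2[of j] by (auto simp: tapp_def)
qed

lemma tapp_temb_snoc: "tapp (temb a) x (p @ [j]) = tapp a (slice j x) p"
  using fun_cong[OF slice_tapp_temb] by (simp add: slice_def)

lemma tapp_temb_Nil: "tapp (temb a) x [] = 0"
  by (simp add: tapp_def temb_Nil)

lemma diag_mat_snoc:
  assumes "length p = length q"
  shows "diag_mat g (p @ [i]) (q @ [j]) = diag_mat g p q * g $ i $ j"
proof -
  have "(\<Prod>t<length p. g $ ((p @ [i]) ! t) $ ((q @ [j]) ! t)) = (\<Prod>t<length p. g $ (p ! t) $ (q ! t))"
    using assms by (auto intro!: prod.cong simp: nth_append)
  then show ?thesis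
    using assms by (simp add: diag_mat_def) (simp add: nth_append)
qed

lemma tapp_diag_mat_snoc:
  "tapp (diag_mat g) x (p @ [j])
    = g $ j $ 1 * tapp (diag_mat g) (slice 1 x) p + g $ j $ 2 * tapp (diag_mat g) (slice 2 x) p"
  unfolding tapp_snoc
  by (simp add: diag_mat_snoc tapp_def slice_def sum_distrib_left sum.distrib[symmetric] mult.assoc mult.left_commute)

lemma tapp_diag_mat_Nil: "tapp (diag_mat g) x [] = x []"
  by (simp add: tapp_def diag_mat_def)

lemma tensor_eqI:
  assumes "x [] = y []" "\<And>p j. x (p @ [j]) = y (p @ [j])"
  shows "x = y"
  using assms by (metis ext rev_exhaust)

section \<open>The conditional expectation\<close>

lemma cond_exp_diff: "cond_exp (a - b) = cond_exp a - cond_exp b"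
  by (simp add: cond_exp_def fun_eq_iff add_divide_distrib diff_divide_distrib)

lemma cond_exp_tscale: "cond_exp (tscale c a) = tscale c (cond_exp a)"
  by (simp add: cond_exp_def tscale_def fun_eq_iff distrib_left add_divide_distrib)

lemma cond_exp_temb: "cond_exp (temb a) = a"
  by (simp add: cond_exp_def temb_def)

text \<open>
  Together with its mirror image, this says that the conditional expectation is a bimodule map
  over the smaller algebra: the partial trace is taken in the last tensor position, where
  \<open>a \<otimes> 1\<close> acts as the identity.
\<close>

lemma cond_exp_temb_left: "cond_exp (temb a \<odot> b) = a \<odot> cond_exp b"
  by (simp add: cond_exp_def tmul_def fun_eq_iff sum_words_Suc temb_snoc sum_distrib_left
      sum.distrib[symmetric] distrib_left sum_divide_distrib)

lemma cond_exp_temb_right: "cond_exp (b \<odot> temb a) = cond_exp b \<odot> a"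
  by (simp add: cond_exp_def tmul_def fun_eq_iff sum_words_Suc temb_snoc sum_distrib_left
      sum.distrib[symmetric] distrib_right add_divide_distrib sum_divide_distrib)

section \<open>Traces\<close>

definition ttrace :: "nat \<Rightarrow> tmat \<Rightarrow> complex" where
  "ttrace n a = (\<Sum>p | length p = n. a p p)"

lemma ttrace_tmul_commute: "ttrace n (a \<odot> b) = ttrace n (b \<odot> a)"
proof -
  have "ttrace n (a \<odot> b) = (\<Sum>p | length p = n. \<Sum>r | length r = n. a p r * b r p)"
    by (auto simp: ttrace_def tmul_def intro!: sum.cong)
  also have "\<dots> = (\<Sum>r | length r = n. \<Sum>p | length p = n. a p r * b r p)"
    by (rule sum.swap)
  also have "\<dots> = ttrace n (b \<odot> a)"
    by (auto simp: ttrace_def tmul_def mult.commute intro!: sum.cong)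
  finally show ?thesis .
qed

lemma ttrace_tscale: "ttrace n (tscale c a) = c * ttrace n a"
  by (simp add: ttrace_def tscale_def sum_distrib_left)

lemma ttrace_cond_exp: "ttrace (Suc n) a = 2 * ttrace n (cond_exp a)"
  by (simp add: ttrace_def cond_exp_def sum_words_Suc sum_divide_distrib[symmetric])

lemma ttrace_temb: "ttrace (Suc n) (temb a) = 2 * ttrace n a"
  by (simp add: ttrace_cond_exp cond_exp_temb)

lemma idempotent_fixes_image:
  assumes "f \<odot> f = f" "x \<in> timage n f"
  shows "tapp f x = x"
  using assms by (auto simp: timage_def tapp_tmul[symmetric])

lemma subspace_timage: "cfun.subspace (timage n f)"
proof (rule cfun.subspaceI)
  have "0 \<in> gspace (tpow n)" by (simp add: mem_tpow)
  then show "0 \<in> timage n f" unfolding timage_def by (metis image_eqI tapp_zero)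
next
  fix x y assume "x \<in> timage n f" "y \<in> timage n f"
  then show "x + y \<in> timage n f"
    unfolding timage_def
    by (auto simp: tapp_add[symmetric] intro!: imageI cfun.subspace_add[OF subspace_tpow])
next
  fix c x assume "x \<in> timage n f"
  then show "cscale c x \<in> timage n f"
    unfolding timage_def
    by (auto simp: tapp_cscale[symmetric] intro!: imageI cfun.subspace_scale[OF subspace_tpow])
qed

lemma timage_subset_tpow: "f \<in> tEnd n \<Longrightarrow> timage n f \<subseteq> gspace (tpow n)"
  by (auto simp: timage_def tapp_in_tpow)

text \<open>
  Write \<open>f x = \<Sum>b\<in>B. \<phi>\<^sub>b(x) b\<close> for a basis \<open>B\<close> of the image. Then the trace of \<open>f\<close> is the
  sum of the values \<open>\<phi>\<^sub>b(b)\<close>, and each of them is 1 because \<open>f\<close> fixes \<open>b\<close>.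
\<close>

lemma ttrace_idempotent:
  assumes f: "f \<in> tEnd n" and idem: "f \<odot> f = f"
  shows "ttrace n f = of_nat (cfun.dim (timage n f))"
proof -
  obtain B where B: "B \<subseteq> timage n f" "cfun.independent B" "timage n f \<subseteq> cfun.span B"
    "card B = cfun.dim (timage n f)"
    using cfun.basis_exists .
  have finB: "finite B"
    using cfun.independent_span_bound[OF finite_imageI[OF finite_words[of n]] B(2)]
      B(1) timage_subset_tpow[OF f] tpow_subset_span[of n] by blast
  have fB: "tapp f x \<in> cfun.span B" if "x \<in> gspace (tpow n)" for x
    using B(3) that by (auto simp: timage_def)
  define \<phi> where "\<phi> b x = cfun.representation B (tapp f x) b" for b x
  have unit: "unit_tensor p \<in> gspace (tpow n)" if "length p = n" for p
    using unit_tensor_in_tpow[of p] that by simp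
  have "ttrace n f = (\<Sum>p | length p = n. tapp f (unit_tensor p) p)"
    by (simp add: ttrace_def tapp_unit_tensor)
  also have "\<dots> = (\<Sum>p | length p = n. \<Sum>b\<in>B. \<phi> b (unit_tensor p) * b p)"
  proof (rule sum.cong[OF refl])
    fix p :: "2 list" assume "p \<in> {p. length p = n}"
    then have "tapp f (unit_tensor p) = (\<Sum>b\<in>B. cscale (\<phi> b (unit_tensor p)) b)"
      unfolding \<phi>_def using cfun.sum_representation_eq[OF B(2) fB[OF unit] finB order_refl] by simp
    then show "tapp f (unit_tensor p) p = (\<Sum>b\<in>B. \<phi> b (unit_tensor p) * b p)"
      by (metis (no_types, lifting) sum.cong sum_fun_apply cscale_def)
  qed
  also have "\<dots> = (\<Sum>b\<in>B. \<Sum>p | length p = n. \<phi> b (unit_tensor p) * b p)"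
    by (rule sum.swap)
  also have "\<dots> = (\<Sum>b\<in>B. 1)"
  proof (rule sum.cong[OF refl])
    fix b assume b: "b \<in> B"
    then have bt: "b \<in> gspace (tpow n)" using B(1) timage_subset_tpow[OF f] by blast
    have span: "tapp f (cscale (b p) (unit_tensor p)) \<in> cfun.span B" if "p \<in> {p. length p = n}" for p
      using that unit by (intro fB cfun.subspace_scale[OF subspace_tpow]) auto
    have "b = tapp f b" using idempotent_fixes_image[OF idem] b B(1) by auto
    also have "\<dots> = tapp f (\<Sum>p | length p = n. cscale (b p) (unit_tensor p))"
      using tensor_expansion[OF bt] by simp
    also have "\<dots> = (\<Sum>p | length p = n. tapp f (cscale (b p) (unit_tensor p)))"
      using linear_on_sum[OF linear_on_tapp subspace_tpow, of "{p. length p = n}" unit_tensor n f b] unit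
      by (simp add: tapp_cscale)
    finally have eq: "b = (\<Sum>p | length p = n. tapp f (cscale (b p) (unit_tensor p)))" .
    have "cfun.representation B b b
        = (\<Sum>p | length p = n. cfun.representation B (tapp f (cscale (b p) (unit_tensor p))) b)"
      using arg_cong[OF eq, of "cfun.representation B"]
        cfun.representation_sum[OF B(2), of "{p. length p = n}" "\<lambda>p. tapp f (cscale (b p) (unit_tensor p))", OF span]
      by simp
    also have "\<dots> = (\<Sum>p | length p = n. b p * \<phi> b (unit_tensor p))"
      unfolding \<phi>_def using unit by (auto intro!: sum.cong simp: tapp_cscale cfun.representation_scale[OF B(2) fB])
    finally show "(\<Sum>p | length p = n. \<phi> b (unit_tensor p) * b p) = 1"
      using cfun.representation_basis[OF B(2) b] by (simp add: mult.commute)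
  qed
  finally show ?thesis using B(4) by simp
qed

section \<open>The antisymmetric tensor and its contraction\<close>

text \<open>
  \<open>cup y\<close> is \<open>y \<otimes> w\<close> for the antisymmetric tensor \<open>w = v\<^sub>-\<^sub>1 \<otimes> v\<^sub>1 - v\<^sub>1 \<otimes> v\<^sub>-\<^sub>1\<close>, and \<open>cap\<close>
  contracts the last two tensor positions with the corresponding alternating form. The entry
  \<open>e_entry i j 1 2\<close> is the coefficient of \<open>v\<^sub>i \<otimes> v\<^sub>j\<close> in \<open>w\<close>.
\<close>

definition cap :: "tensor \<Rightarrow> tensor" where
  "cap x = (\<lambda>p. x (p @ [1, 2]) - x (p @ [2, 1]))"

definition cup :: "tensor \<Rightarrow> tensor" where
  "cup y = (\<lambda>p. if length p < 2 then 0
     else e_entry (last (butlast p)) (last p) 1 2 * y (butlast (butlast p)))"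

lemma cap_slice: "cap x = slice 1 (slice 2 x) - slice 2 (slice 1 x)"
  by (simp add: cap_def slice_def fun_eq_iff)

lemma cup_simps [simp]:
  "cup y [] = 0" "cup y [i] = 0" "cup y (p @ [i, j]) = e_entry i j 1 2 * y p"
  by (simp_all add: cup_def butlast_append)

lemma slice_slice_cup: "slice i (slice j (cup y)) = cscale (e_entry i j 1 2) y"
  by (simp add: slice_def cscale_def)

lemma cap_in_tpow: "x \<in> gspace (tpow (n + 2)) \<Longrightarrow> cap x \<in> gspace (tpow n)"
  by (simp add: mem_tpow cap_def)

lemma cup_in_tpow: "y \<in> gspace (tpow n) \<Longrightarrow> cup y \<in> gspace (tpow (n + 2))"
  by (auto simp: mem_tpow cup_def)

lemma cap_add: "cap (x + y) = cap x + cap y"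
  by (simp add: cap_def fun_eq_iff)

lemma cap_cscale: "cap (cscale c x) = cscale c (cap x)"
  by (simp add: cap_def cscale_def right_diff_distrib)

lemma cup_cscale: "cup (cscale c y) = cscale c (cup y)"
  by (simp add: cup_def cscale_def fun_eq_iff)

lemma cap_zero: "cap 0 = 0"
  by (simp add: cap_def fun_eq_iff)

lemma cup_zero: "cup 0 = 0"
  by (simp add: cup_def fun_eq_iff)

lemma tensor_eqI2:
  assumes "x [] = y []" "\<And>i. x [i] = y [i]" "\<And>p i j. x (p @ [i, j]) = y (p @ [i, j])"
  shows "x = y"
proof
  fix p show "x p = y p" by (cases p rule: two_letters_cases) (use assms in auto)
qed

lemma cup_tapp: "cup (tapp a y) = tapp (temb (temb a)) (cup y)"
proof (rule tensor_eqI2)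
  fix p i j
  have "tapp (temb (temb a)) (cup y) ((p @ [i]) @ [j]) = tapp a (slice i (slice j (cup y))) p"
    by (simp only: tapp_temb_snoc)
  then show "cup (tapp a y) (p @ [i, j]) = tapp (temb (temb a)) (cup y) (p @ [i, j])"
    by (simp add: slice_slice_cup tapp_cscale) (simp add: cscale_def)
next
  fix i
  have "tapp (temb (temb a)) (cup y) ([] @ [i]) = 0"
    unfolding tapp_temb_snoc by (rule tapp_temb_Nil)
  then show "cup (tapp a y) [i] = tapp (temb (temb a)) (cup y) [i]" by simp
qed (simp add: tapp_temb_Nil)

lemma cap_tapp: "cap (tapp (temb (temb a)) x) = tapp a (cap x)"
  by (simp add: cap_slice slice_tapp_temb tapp_minus)

text \<open>
  Contracting \<open>w\<close> with itself after \<open>a\<close> has acted on its first factor closes up the last strand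
  of \<open>a\<close>; both basis vectors contribute with sign \<open>+1\<close>. This turns the conditional expectation
  into a composite of maps that visibly commute with the group.
\<close>

lemma tapp_cond_exp: "tapp (tscale 2 (cond_exp a)) y = cap (tapp (temb a) (cup y))"
proof
  fix p
  have two: "tscale 2 (cond_exp a) p q = a (p @ [1]) (q @ [1]) + a (p @ [2]) (q @ [2])" for p q
    by (simp add: tscale_def cond_exp_def)
  have s: "slice l (cup y) (q @ [i]) = e_entry i l 1 2 * y q" for q i l
    by (simp add: slice_def)
  have "cap (tapp (temb a) (cup y)) p
      = tapp (temb a) (cup y) ((p @ [1]) @ [2]) - tapp (temb a) (cup y) ((p @ [2]) @ [1])"
    by (simp add: cap_def)
  also have "\<dots> = tapp a (slice 2 (cup y)) (p @ [1]) - tapp a (slice 1 (cup y)) (p @ [2])"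
    by (simp only: tapp_temb_snoc)
  also have "\<dots> = (\<Sum>q | length q = length p. (a (p @ [1]) (q @ [1]) + a (p @ [2]) (q @ [2])) * y q)"
    unfolding tapp_snoc s
    by (simp add: e_entry_def sum_subtractf[symmetric] distrib_right)
  finally show "tapp (tscale 2 (cond_exp a)) y p = cap (tapp (temb a) (cup y)) p"
    by (simp only: tapp_def two)
qed

lemma tl_e_last:
  assumes "length p = n" "length q = n"
  shows "tl_e (n + 2) (n + 1) (p @ [i, j]) (q @ [l, m]) = (if p = q then e_entry i j l m else 0)"
proof -
  have "(\<forall>t<n + 2. t \<noteq> n \<and> t \<noteq> n + 1 \<longrightarrow> (p @ [i, j]) ! t = (q @ [l, m]) ! t) \<longleftrightarrow> p = q"
    using assms by (auto simp: nth_append list_eq_iff_nth_eq)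
  then show ?thesis using assms by (simp add: tl_e_def nth_append)
qed

text \<open>
  \<open>e\<close> has rank one: it sends a tensor of \<open>V \<otimes> V\<close> to the multiple of \<open>w\<close> given by the alternating
  form. All relations for \<open>e\<^sub>i\<close> used here come from this factorization.
\<close>

lemma tl_e_eq_cup_cap:
  assumes x: "x \<in> gspace (tpow (n + 2))"
  shows "tapp (tl_e (n + 2) (n + 1)) x = cup (cap x)"
proof -
  have E: "tapp (tl_e (n + 2) (n + 1)) x \<in> gspace (tpow (n + 2))"
    using tEnd_tl_e by (rule tapp_in_tpow)
  have C: "cup (cap x) \<in> gspace (tpow (n + 2))"
    using x by (intro cup_in_tpow cap_in_tpow)
  show ?thesis
  proof (rule tensor_eqI2)
    fix p :: "2 list" and i j
    show "tapp (tl_e (n + 2) (n + 1)) x (p @ [i, j]) = cup (cap x) (p @ [i, j])"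
    proof (cases "length p = n")
      case True
      let ?h = "\<lambda>q l m. tl_e (n + 2) (n + 1) (p @ [i, j]) (q @ [l, m]) * x (q @ [l, m])"
      have "tapp (tl_e (n + 2) (n + 1)) x (p @ [i, j])
          = (\<Sum>q | length q = n. ?h q 1 1 + ?h q 1 2 + (?h q 2 1 + ?h q 2 2))"
        using True by (simp add: tapp_def sum_words_Suc)
      also have "\<dots> = (\<Sum>q | length q = n. if q = p then e_entry i j 1 1 * x (p @ [1, 1]) + e_entry i j 1 2 * x (p @ [1, 2])
          + (e_entry i j 2 1 * x (p @ [2, 1]) + e_entry i j 2 2 * x (p @ [2, 2])) else 0)"
        using True tl_e_last[of p n _ i j] by (intro sum.cong[OF refl]) auto
      also have "\<dots> = e_entry i j 1 1 * x (p @ [1, 1]) + e_entry i j 1 2 * x (p @ [1, 2])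
          + (e_entry i j 2 1 * x (p @ [2, 1]) + e_entry i j 2 2 * x (p @ [2, 2]))"
        using True by (subst sum_words_delta) simp
      also have "\<dots> = cup (cap x) (p @ [i, j])"
        using exhaust_2[of i] exhaust_2[of j] by (auto simp: e_entry_def cap_def)
      finally show ?thesis .
    next
      case False
      then have "length (p @ [i, j]) \<noteq> n + 2" by simp
      then show ?thesis using E C unfolding mem_tpow by metis
    qed
  qed (use E C in \<open>auto simp: mem_tpow\<close>)
qed

text \<open>
  In terms of the factorization, the left side is
  \<open>cup \<circ> (cap \<circ> (a \<otimes> 1) \<circ> cup) \<circ> cap\<close>, and the bracket is twice the conditional expectation.
\<close>

lemma tl_e_sandwich:
  assumes a: "a \<in> tEnd (n + 1)"
  shows "tl_e (n + 2) (n + 1) \<odot> temb a \<odot> tl_e (n + 2) (n + 1)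
    = temb (temb (tscale 2 (cond_exp a))) \<odot> tl_e (n + 2) (n + 1)"
proof (rule tmat_eqI[of _ "n + 2"])
  have ta: "temb a \<in> tEnd (n + 2)" using tEnd_temb[OF a] by simp
  have c: "temb (temb (tscale 2 (cond_exp a))) \<in> tEnd (n + 2)"
    using a by (auto intro!: tEnd_temb tEnd_tscale tEnd_cond_exp simp: numeral_2_eq_2)
  show "tl_e (n + 2) (n + 1) \<odot> temb a \<odot> tl_e (n + 2) (n + 1) \<in> tEnd (n + 2)"
    "temb (temb (tscale 2 (cond_exp a))) \<odot> tl_e (n + 2) (n + 1) \<in> tEnd (n + 2)"
    by (intro tEnd_tmul ta c tEnd_tl_e)+
  fix x assume "x \<in> gspace (tpow (n + 2))"
  then show "tapp (tl_e (n + 2) (n + 1) \<odot> temb a \<odot> tl_e (n + 2) (n + 1)) x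
      = tapp (temb (temb (tscale 2 (cond_exp a))) \<odot> tl_e (n + 2) (n + 1)) x"
    using tapp_in_tpow[OF ta]
    by (simp only: tapp_tmul tl_e_eq_cup_cap cup_tapp[symmetric] tapp_cond_exp)
qed

lemma tl_e_commute_last:
  assumes a: "a \<in> tEnd n"
  shows "temb (temb a) \<odot> tl_e (n + 2) (n + 1) = tl_e (n + 2) (n + 1) \<odot> temb (temb a)"
proof (rule tmat_eqI[of _ "n + 2"])
  have ta: "temb (temb a) \<in> tEnd (n + 2)" using tEnd_temb[OF tEnd_temb[OF a]] by simp
  show "temb (temb a) \<odot> tl_e (n + 2) (n + 1) \<in> tEnd (n + 2)"
    "tl_e (n + 2) (n + 1) \<odot> temb (temb a) \<in> tEnd (n + 2)"
    by (intro tEnd_tmul ta tEnd_tl_e)+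
  fix x assume "x \<in> gspace (tpow (n + 2))"
  then show "tapp (temb (temb a) \<odot> tl_e (n + 2) (n + 1)) x = tapp (tl_e (n + 2) (n + 1) \<odot> temb (temb a)) x"
    using tapp_in_tpow[OF ta]
    by (simp only: tapp_tmul tl_e_eq_cup_cap cup_tapp[symmetric] cap_tapp)
qed

lemma temb_tl_e:
  assumes "1 \<le> j" "j < n"
  shows "temb (tl_e n j) = tl_e (Suc n) j"
proof (intro ext)
  fix p q :: "2 list"
  show "temb (tl_e n j) p q = tl_e (Suc n) j p q"
  proof (cases "length p = Suc n \<and> length q = Suc n")
    case True
    then obtain p' x q' y where pq: "p = p' @ [x]" "q = q' @ [y]" "length p' = n" "length q' = n"
      by (metis length_append_singleton nat.inject rev_exhaust list.size(3) nat.distinct(1))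
    have *: "(\<forall>t<Suc n. t \<noteq> j - 1 \<and> t \<noteq> j \<longrightarrow> p ! t = q ! t)
      \<longleftrightarrow> x = y \<and> (\<forall>t<n. t \<noteq> j - 1 \<and> t \<noteq> j \<longrightarrow> p' ! t = q' ! t)"
      using assms pq by (auto simp: nth_append less_Suc_eq)
    have "p ! (j - 1) = p' ! (j - 1)" "p ! j = p' ! j" "q ! (j - 1) = q' ! (j - 1)" "q ! j = q' ! j"
      using assms pq by (auto simp: nth_append)
    then have "tl_e (Suc n) j p q = (if \<forall>t<Suc n. t \<noteq> j - 1 \<and> t \<noteq> j \<longrightarrow> p ! t = q ! t
        then e_entry (p' ! (j - 1)) (p' ! j) (q' ! (j - 1)) (q' ! j) else 0)"
      unfolding tl_e_def using True by auto
    also have "\<dots> = (if x = y then tl_e n j p' q' else 0)"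
      unfolding * using pq by (simp add: tl_e_def)
    finally show ?thesis by (simp add: pq(1,2) temb_snoc)
  next
    case False
    then show ?thesis
      using tEnd_temb[OF tEnd_tl_e[of n j]] tEnd_tl_e[of "Suc n" j] unfolding tEnd_def by auto
  qed
qed

lemma temb_tmul: "temb (a \<odot> b) = temb a \<odot> temb b"
proof (intro ext)
  fix p q
  show "temb (a \<odot> b) p q = (temb a \<odot> temb b) p q"
  proof (cases p rule: rev_cases)
    case (snoc p' i)
    show ?thesis
    proof (cases q rule: rev_cases)
      case (snoc q' j)
      then show ?thesis
        using \<open>p = p' @ [i]\<close> exhaust_2[of i] exhaust_2[of j]
        by (auto simp: temb_snoc tmul_def sum_words_Suc)
    qed (simp add: temb_Nil tmul_def)
  qed (simp add: temb_Nil tmul_def)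
qed

lemma temb_tscale: "temb (tscale c a) = tscale c (temb a)"
  by (simp add: temb_def tscale_def fun_eq_iff)

lemma tEnd_temb_pow: "a \<in> tEnd n \<Longrightarrow> (temb ^^ d) a \<in> tEnd (n + d)"
  by (induction d) (auto intro: tEnd_temb)

text \<open>
  Since \<open>e\<^sub>j\<close> is a \<open>cup\<close> after a \<open>cap\<close> at level \<open>j + 1\<close> and all later levels only tensor with
  the identity, the induction starts at \<open>n = j + 1\<close>, where \<open>a\<close> does not reach the last two
  positions.
\<close>

lemma tl_e_commute:
  assumes a: "a \<in> tEnd m" and "m < j" "j < n"
  shows "(temb ^^ (n - m)) a \<odot> tl_e n j = tl_e n j \<odot> (temb ^^ (n - m)) a"
  using \<open>j < n\<close>
proof (induction n)
  case (Suc n)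
  show ?case
  proof (cases "j = n")
    case True
    let ?b = "(temb ^^ (n - 1 - m)) a"
    have "?b \<in> tEnd (m + (n - 1 - m))" by (rule tEnd_temb_pow[OF a])
    then have "?b \<in> tEnd (n - 1)" using True \<open>m < j\<close> by simp
    moreover have "(temb ^^ (Suc n - m)) a = temb (temb ?b)"
    proof -
      have "Suc n - m = Suc (Suc (n - 1 - m))" using True \<open>m < j\<close> by simp
      then show ?thesis by (simp only: funpow.simps o_apply)
    qed
    moreover have "n - 1 + 2 = Suc n" "n - 1 + 1 = j" using True \<open>m < j\<close> by auto
    ultimately show ?thesis using tl_e_commute_last[of ?b "n - 1"] by metis
  next
    case False
    then have "j < n" using Suc.prems by simp
    have "Suc n - m = Suc (n - m)" using \<open>j < n\<close> \<open>m < j\<close> by simp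
    then have pow: "(temb ^^ (Suc n - m)) a = temb ((temb ^^ (n - m)) a)"
      by (simp only: funpow.simps o_apply)
    have "tl_e (Suc n) j = temb (tl_e n j)"
      using \<open>j < n\<close> \<open>m < j\<close> by (simp add: temb_tl_e)
    then show ?thesis unfolding pow by (simp only: temb_tmul[symmetric] Suc.IH[OF \<open>j < n\<close>])
  qed
qed simp

text \<open>
  On \<open>V \<otimes> V\<close>, \<open>e\<close> is the identity minus the flip. The partial traces of the two are 1 and a half
  of the identity.
\<close>

lemma tapp_cond_exp_tl_e:
  assumes x: "x \<in> gspace (tpow (n + 1))"
  shows "tapp (cond_exp (tl_e (n + 2) (n + 1))) x = cscale (1/2) x"
proof
  fix p
  define e where "e = cond_exp (tl_e (n + 2) (n + 1))"
  have *: "e p q = (if q = p then 1/2 else 0)"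
    if "length p = n + 1" "length q = n + 1" for p q
  proof -
    obtain p' i q' l where pq: "p = p' @ [i]" "q = q' @ [l]" "length p' = n" "length q' = n"
      using \<open>length p = n + 1\<close> \<open>length q = n + 1\<close>
      by (metis Suc_eq_plus1 length_append_singleton nat.inject rev_exhaust list.size(3) nat.distinct(1))
    show ?thesis
      using tl_e_last[of p' n q' i _ l] pq exhaust_2[of i] exhaust_2[of l]
      by (auto simp: e_def cond_exp_def e_entry_def)
  qed
  show "tapp (cond_exp (tl_e (n + 2) (n + 1))) x p = cscale (1/2) x p"
  proof (cases "length p = n + 1")
    case True
    then have "tapp e x p = (\<Sum>q | length q = n + 1. if q = p then 1/2 * x q else 0)"
      unfolding tapp_def by (intro sum.cong) (auto simp: *)
    then show ?thesis unfolding e_def[symmetric] using True by (simp add: sum_words_delta cscale_def)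
  next
    case False
    have "tapp (cond_exp (tl_e (n + 2) (n + 1))) x \<in> gspace (tpow (n + 1))"
      by (intro tapp_in_tpow tEnd_cond_exp) (simp add: tEnd_tl_e)
    then show ?thesis using False x by (simp add: mem_tpow cscale_def)
  qed
qed

section \<open>Equivariance\<close>

lemma slice_tapp_diag_mat: "slice j (tapp (diag_mat g) x)
    = cscale (g $ j $ 1) (tapp (diag_mat g) (slice 1 x)) + cscale (g $ j $ 2) (tapp (diag_mat g) (slice 2 x))"
  by (simp add: fun_eq_iff slice_def[of j] tapp_diag_mat_snoc cscale_def)

lemma slice_add: "slice j (x + y) = slice j x + slice j y"
  by (simp add: slice_def fun_eq_iff)

lemma slice_cscale: "slice j (cscale c x) = cscale c (slice j x)"
  by (simp add: slice_def cscale_def)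

text \<open>
  Applying \<open>g\<close> to both arguments of the alternating form multiplies it by the determinant of \<open>g\<close>.
  This and the next lemma are the place where the group being inside \<open>SU\<^sub>2\<close> enters.
\<close>

lemma cap_equivariant:
  assumes "det g = 1"
  shows "cap (tapp (diag_mat g) x) = tapp (diag_mat g) (cap x)"
proof
  fix p
  let ?s = "\<lambda>i j. tapp (diag_mat g) (slice i (slice j x)) p"
  have "cap (tapp (diag_mat g) x) p = (g$1$1 * g$2$2 - g$1$2 * g$2$1) * (?s 1 2 - ?s 2 1)"
    by (simp add: cap_slice slice_tapp_diag_mat slice_add slice_cscale)
       (simp add: cscale_def algebra_simps)
  also have "\<dots> = tapp (diag_mat g) (cap x) p"
    using assms by (simp add: det_2 cap_slice tapp_minus)
  finally show "cap (tapp (diag_mat g) x) p = tapp (diag_mat g) (cap x) p" .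
qed

lemma cup_equivariant:
  assumes "det g = 1"
  shows "cup (tapp (diag_mat g) y) = tapp (diag_mat g) (cup y)"
proof (rule tensor_eqI2)
  fix p i j
  have "tapp (diag_mat g) (cup y) ((p @ [i]) @ [j])
    = (g$j$2 * g$i$1 - g$j$1 * g$i$2) * tapp (diag_mat g) y p"
    by (simp only: tapp_diag_mat_snoc slice_slice_cup tapp_cscale)
       (simp add: cscale_def e_entry_def algebra_simps)
  also have "g$j$2 * g$i$1 - g$j$1 * g$i$2 = e_entry i j 1 2"
    using assms exhaust_2[of i] exhaust_2[of j] by (auto simp: e_entry_def det_2 algebra_simps)
  finally show "cup (tapp (diag_mat g) y) (p @ [i, j]) = tapp (diag_mat g) (cup y) (p @ [i, j])"
    by simp
next
  fix i
  show "cup (tapp (diag_mat g) y) [i] = tapp (diag_mat g) (cup y) [i]"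
    using tapp_diag_mat_snoc[of g "cup y" "[]" i] by (simp add: tapp_diag_mat_Nil slice_def)
qed (simp add: tapp_diag_mat_Nil)

text \<open>
  The value of \<open>tapp\<close> at a word only depends on words of the same length, so commutation on
  \<open>V\<^sup>\<otimes>\<^sup>n\<close> already gives commutation on all functions on words, and the domain can be dropped
  from calculations.
\<close>

lemma centralizer_iff:
  "a \<in> centralizer G n \<longleftrightarrow>
     a \<in> tEnd n \<and> (\<forall>g\<in>G. \<forall>x. tapp a (tapp (diag_mat g) x) = tapp (diag_mat g) (tapp a x))"
proof -
  have "tapp a (tapp (diag_mat g) x) = tapp (diag_mat g) (tapp a x)"
    if a: "a \<in> tEnd n" and c: "\<forall>x\<in>gspace (tpow n). tapp a (tapp (diag_mat g) x) = tapp (diag_mat g) (tapp a x)"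
    for g x
  proof
    fix p
    define y where "y = (\<lambda>q. if length q = n then x q else 0)"
    have y: "y \<in> gspace (tpow n)" by (simp add: y_def mem_tpow)
    show "tapp a (tapp (diag_mat g) x) p = tapp (diag_mat g) (tapp a x) p"
    proof (cases "length p = n")
      case True
      have "tapp a (tapp (diag_mat g) x) p = tapp a (tapp (diag_mat g) y) p"
        using True by (intro tapp_cong) (simp add: y_def)
      moreover have "tapp (diag_mat g) (tapp a x) p = tapp (diag_mat g) (tapp a y) p"
        using True by (intro tapp_cong) (simp add: y_def)
      ultimately show ?thesis using c y by simp
    next
      case False
      have "tapp (diag_mat g) (tapp a x) p = tapp (diag_mat g) 0 p"
        using False tapp_in_tpow[OF a, of x] by (intro tapp_cong) (simp add: mem_tpow)
      then show ?thesis
        using False tapp_in_tpow[OF a, of "tapp (diag_mat g) x"] by (simp add: mem_tpow tapp_zero)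
    qed
  qed
  then show ?thesis by (auto simp: centralizer_def gact_tpow)
qed

lemma centralizer_tmul: "a \<in> centralizer G n \<Longrightarrow> b \<in> centralizer G n \<Longrightarrow> a \<odot> b \<in> centralizer G n"
  by (simp add: centralizer_iff tEnd_tmul tapp_tmul)

lemma centralizer_diff: "a \<in> centralizer G n \<Longrightarrow> b \<in> centralizer G n \<Longrightarrow> a - b \<in> centralizer G n"
  by (simp add: centralizer_iff tEnd_diff tapp_diff_mat tapp_minus)

lemma centralizer_tscale: "a \<in> centralizer G n \<Longrightarrow> tscale c a \<in> centralizer G n"
  by (simp add: centralizer_iff tEnd_tscale tapp_tscale tapp_cscale)

lemma centralizer_temb:
  assumes "a \<in> centralizer G n"
  shows "temb a \<in> centralizer G (Suc n)"
  unfolding centralizer_iff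
proof (intro conjI ballI allI)
  show "temb a \<in> tEnd (Suc n)" using assms by (simp add: centralizer_iff tEnd_temb)
  fix g x assume g: "g \<in> G"
  show "tapp (temb a) (tapp (diag_mat g) x) = tapp (diag_mat g) (tapp (temb a) x)"
  proof (rule tensor_eqI)
    fix p j
    show "tapp (temb a) (tapp (diag_mat g) x) (p @ [j]) = tapp (diag_mat g) (tapp (temb a) x) (p @ [j])"
      using assms g unfolding centralizer_iff tapp_temb_snoc tapp_diag_mat_snoc slice_tapp_diag_mat slice_tapp_temb
      by (simp add: tapp_add tapp_cscale) (simp add: cscale_def)
  qed (simp add: tapp_temb_Nil tapp_diag_mat_Nil)
qed

lemma centralizer_tl_e_last:
  assumes "\<And>g. g \<in> G \<Longrightarrow> det g = 1"
  shows "tl_e (n + 2) (n + 1) \<in> centralizer G (n + 2)"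
  unfolding centralizer_def gact_tpow using tEnd_tl_e tapp_diag_mat_in_tpow
  by (auto simp only: tl_e_eq_cup_cap cap_equivariant cup_equivariant assms)

lemma centralizer_cond_exp:
  assumes "\<And>g. g \<in> G \<Longrightarrow> det g = 1" and "a \<in> centralizer G (n + 1)"
  shows "tscale 2 (cond_exp a) \<in> centralizer G n"
  using assms centralizer_temb[OF assms(2)]
  by (simp add: centralizer_iff tEnd_tscale tEnd_cond_exp tapp_cond_exp cap_equivariant cup_equivariant)

section \<open>Submodules of tensor powers\<close>

lemma is_submodule_timage:
  assumes "f \<in> centralizer G n"
  shows "is_submodule G (tpow n) (timage n f)"
  unfolding is_submodule_def
proof (intro conjI ballI subsetI)
  show "cfun.subspace (timage n f)" by (rule subspace_timage)
  show "x \<in> gspace (tpow n)" if "x \<in> timage n f" for x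
    using assms that timage_subset_tpow by (auto simp: centralizer_iff)
  fix g y assume g: "g \<in> G" and "y \<in> gact (tpow n) g ` timage n f"
  then obtain x where x: "x \<in> gspace (tpow n)" "y = tapp (diag_mat g) (tapp f x)"
    by (auto simp: timage_def gact_tpow)
  from x(1) have "tapp (diag_mat g) x \<in> gspace (tpow n)" by (rule tapp_diag_mat_in_tpow)
  then show "y \<in> timage n f"
    using assms g x(2) unfolding timage_def centralizer_iff by (metis image_eqI)
qed

lemma gdim_submodule:
  assumes "is_submodule G (tpow n) U" "gmod_iso G (submod (tpow n) U) M"
  shows "gdim M = cfun.dim U"
proof -
  from assms(2) obtain f where "bij_betw f U (gspace M)" "linear_on U f"
    by (auto simp: gmod_iso_def)
  moreover have "U \<subseteq> cfun.span (unit_tensor ` {q. length q = n})"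
    using assms(1) tpow_subset_span[of n] by (auto simp: is_submodule_def)
  ultimately show ?thesis
    using dim_linear_bij[of U f "gspace M"] assms(1) finite_imageI[OF finite_words[of n]]
    unfolding gdim_def is_submodule_def by blast
qed

lemma submodule_trivial:
  assumes U: "is_submodule G (tpow n) U" and iso: "gmod_iso G (submod (tpow n) U) M"
    and irr: "irreducible_gmod G M" and K: "is_submodule G (tpow n) K" "K \<subseteq> U"
  shows "K = {0} \<or> K = U"
proof -
  from iso obtain f where f: "bij_betw f U (gspace M)" "linear_on U f"
    and eq: "\<And>g x. g \<in> G \<Longrightarrow> x \<in> U \<Longrightarrow> f (tapp (diag_mat g) x) = gact M g (f x)"
    by (auto simp: gmod_iso_def gact_tpow)
  have subU: "cfun.subspace U" and subK: "cfun.subspace K"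
    using U K by (auto simp: is_submodule_def)
  have inj: "inj_on f U" and img: "f ` U = gspace M" using f(1) by (auto simp: bij_betw_def)
  have f0: "f 0 = 0" by (rule linear_on_zero[OF f(2) subU])
  have "is_submodule G M (f ` K)"
    unfolding is_submodule_def
  proof (intro conjI ballI cfun.subspaceI)
    show "f ` K \<subseteq> gspace M" using img K(2) by blast
    show "0 \<in> f ` K" using f0 cfun.subspace_0[OF subK] by (metis image_eqI)
    fix x y assume "x \<in> f ` K" "y \<in> f ` K"
    then obtain u v where uv: "u \<in> K" "v \<in> K" "x = f u" "y = f v" by auto
    then have "x + y = f (u + v)" using f(2) K(2) unfolding linear_on_def by (metis subsetD)
    then show "x + y \<in> f ` K" using cfun.subspace_add[OF subK uv(1,2)] by blast
  next
    fix c x assume "x \<in> f ` K"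
    then obtain u where u: "u \<in> K" "x = f u" by auto
    then have "cscale c x = f (cscale c u)" using f(2) K(2) unfolding linear_on_def by (metis subsetD)
    then show "cscale c x \<in> f ` K" using cfun.subspace_scale[OF subK u(1)] by blast
  next
    fix g assume g: "g \<in> G"
    show "gact M g ` f ` K \<subseteq> f ` K"
    proof
      fix z assume "z \<in> gact M g ` f ` K"
      then obtain u where u: "u \<in> K" "z = gact M g (f u)" by auto
      then have "z = f (tapp (diag_mat g) u)" using eq[OF g] K(2) by auto
      moreover have "tapp (diag_mat g) u \<in> K"
        using K(1) g u(1) by (auto simp: is_submodule_def gact_tpow)
      ultimately show "z \<in> f ` K" by blast
    qed
  qed
  then consider "f ` K = {0}" | "f ` K = gspace M"
    using irr by (auto simp: irreducible_gmod_def)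
  then show ?thesis
  proof cases
    case 1
    have "x = 0" if "x \<in> K" for x
    proof (rule inj_onD[OF inj])
      show "f x = f 0" using 1 that f0 by auto
      show "x \<in> U" "0 \<in> U" using that K(2) cfun.subspace_0[OF subU] by auto
    qed
    then show ?thesis using cfun.subspace_0[OF subK] by blast
  next
    case 2
    then show ?thesis using img inj K(2) by (metis inj_on_image_eq_iff order_refl)
  qed
qed

lemma submodule_nonzero:
  assumes "is_submodule G (tpow n) U" "gmod_iso G (submod (tpow n) U) M" "irreducible_gmod G M"
  shows "U \<noteq> {0}"
proof
  assume "U = {0}"
  from assms(2) obtain f where "bij_betw f U (gspace M)" "linear_on U f"
    by (auto simp: gmod_iso_def)
  then have "gspace M = {0}"
    using linear_on_zero assms(1) \<open>U = {0}\<close> unfolding bij_betw_def is_submodule_def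
    by (metis image_empty image_insert)
  then show False using assms(3) by (simp add: irreducible_gmod_def)
qed

lemma dim_nonzero:
  assumes "is_submodule G (tpow n) U" "gmod_iso G (submod (tpow n) U) M" "irreducible_gmod G M"
  shows "cfun.dim U \<noteq> 0"
proof
  assume "cfun.dim U = 0"
  moreover have "cfun.dim {0 :: tensor} = 0"
    by (metis cfun.span_empty cfun.dim_span cfun.dim_eq_card_independent cfun.independent_empty card.empty)
  moreover have "U \<subseteq> cfun.span (unit_tensor ` {q. length q = n})"
    using assms(1) tpow_subset_span[of n] by (auto simp: is_submodule_def)
  ultimately have "{0} = U"
    using subspace_eq_of_dim_le[of "{0}" U "unit_tensor ` {q. length q = n}"] assms(1)
      finite_imageI[OF finite_words[of n]] cfun.subspace_single_0 cfun.subspace_0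
    unfolding is_submodule_def by (metis empty_subsetI insert_subset order_refl)
  then show False using submodule_nonzero[OF assms] by simp
qed

text \<open>
  Schur's lemma: an eigenspace of \<open>t\<close> on \<open>U\<close> is a nonzero submodule, hence all of \<open>U\<close>.
\<close>

lemma schur_scalar:
  assumes U: "is_submodule G (tpow n) U" and iso: "gmod_iso G (submod (tpow n) U) M"
    and irr: "irreducible_gmod G M"
    and t: "t \<in> centralizer G n" and tU: "\<And>x. x \<in> U \<Longrightarrow> tapp t x \<in> U"
  shows "\<exists>c. \<forall>x\<in>U. tapp t x = cscale c x"
proof -
  have subU: "cfun.subspace U" and Un: "U \<subseteq> gspace (tpow n)"
    and stable: "\<And>g x. g \<in> G \<Longrightarrow> x \<in> U \<Longrightarrow> tapp (diag_mat g) x \<in> U"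
    using U by (auto simp: is_submodule_def gact_tpow)
  have "U \<subseteq> cfun.span (unit_tensor ` {q. length q = n})"
    using Un tpow_subset_span by blast
  then obtain c x where cx: "x \<in> U" "x \<noteq> 0" "tapp t x = cscale c x"
    using eigenvector_exists[of "tapp t" U, OF tapp_add tapp_cscale subU submodule_nonzero[OF U iso irr] tU]
      finite_imageI[OF finite_words[of n]] by blast
  let ?K = "{x \<in> U. tapp t x = cscale c x}"
  have "is_submodule G (tpow n) ?K"
    unfolding is_submodule_def
  proof (intro conjI ballI cfun.subspaceI)
    show "0 \<in> ?K" using cfun.subspace_0[OF subU] by (simp only: mem_Collect_eq tapp_zero cfun.scale_zero_right)
    show "x + y \<in> ?K" if "x \<in> ?K" "y \<in> ?K" for x y
      using that cfun.subspace_add[OF subU] by (simp only: mem_Collect_eq tapp_add cfun.scale_right_distrib)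
    show "cscale d x \<in> ?K" if "x \<in> ?K" for d x
      using that cfun.subspace_scale[OF subU] by (simp add: tapp_cscale mult.commute)
    show "?K \<subseteq> gspace (tpow n)" using Un by blast
    fix g assume g: "g \<in> G"
    then have "tapp t (tapp (diag_mat g) x) = tapp (diag_mat g) (tapp t x)" for x
      using t by (simp add: centralizer_iff)
    then show "gact (tpow n) g ` ?K \<subseteq> ?K"
      using stable[OF g] by (auto simp: gact_tpow tapp_cscale)
  qed
  then have "?K = {0} \<or> ?K = U" using submodule_trivial[OF U iso irr] by blast
  then have "?K = U" using cx by blast
  then show ?thesis by blast
qed

text \<open>
  The kernel of the contraction on \<open>W\<close> is a submodule, so if the contraction did not vanish, it
  would embed \<open>W\<close> into \<open>V\<^sup>\<otimes>\<^sup>n\<close>, where \<open>\<nu>\<close> does not occur.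
\<close>

lemma cap_vanishes:
  assumes det: "\<And>g. g \<in> G \<Longrightarrow> det g = 1"
    and W: "is_submodule G (tpow (n + 2)) W" and iso: "gmod_iso G (submod (tpow (n + 2)) W) (M \<nu>)"
    and irr: "irreducible_gmod G (M \<nu>)" and \<nu>: "\<nu> \<in> \<Lambda>" "\<nu> \<notin> Lev G \<Lambda> M (int n)"
    and w: "w \<in> W"
  shows "cap w = 0"
proof -
  have subW: "cfun.subspace W" and Wn: "W \<subseteq> gspace (tpow (n + 2))"
    and stable: "\<And>g x. g \<in> G \<Longrightarrow> x \<in> W \<Longrightarrow> tapp (diag_mat g) x \<in> W"
    using W by (auto simp: is_submodule_def gact_tpow)
  let ?K = "{x \<in> W. cap x = 0}"
  have "is_submodule G (tpow (n + 2)) ?K"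
    unfolding is_submodule_def
  proof (intro conjI ballI cfun.subspaceI)
    show "0 \<in> ?K" using cfun.subspace_0[OF subW] by (simp only: mem_Collect_eq cap_zero)
    show "x + y \<in> ?K" if "x \<in> ?K" "y \<in> ?K" for x y
      using that cfun.subspace_add[OF subW] by (simp only: mem_Collect_eq cap_add add_0)
    show "cscale d x \<in> ?K" if "x \<in> ?K" for d x
      using that cfun.subspace_scale[OF subW] by (simp only: mem_Collect_eq cap_cscale cfun.scale_zero_right)
    show "?K \<subseteq> gspace (tpow (n + 2))" using Wn by blast
    fix g assume g: "g \<in> G"
    show "gact (tpow (n + 2)) g ` ?K \<subseteq> ?K"
      using stable[OF g] cap_equivariant[OF det[OF g]] tapp_zero by (auto simp only: gact_tpow mem_Collect_eq)
  qed
  then have "?K = {0} \<or> ?K = W" using submodule_trivial[OF W iso irr] by blast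
  moreover have "?K \<noteq> {0}"
  proof
    assume K: "?K = {0}"
    have inj: "inj_on cap W"
    proof (rule inj_onI)
      fix x y assume xy: "x \<in> W" "y \<in> W" "cap x = cap y"
      have "cap (x - y) = 0" using xy(3) unfolding cap_def fun_eq_iff by (simp add: algebra_simps)
      then have "x - y \<in> ?K" using cfun.subspace_diff[OF subW xy(1,2)] by blast
      then show "x = y" unfolding K by simp
    qed
    have sub: "is_submodule G (tpow n) (cap ` W)"
      unfolding is_submodule_def
    proof (intro conjI ballI cfun.subspaceI)
      show "0 \<in> cap ` W" using cfun.subspace_0[OF subW] cap_zero by (metis image_eqI)
      show "x + y \<in> cap ` W" if "x \<in> cap ` W" "y \<in> cap ` W" for x y
        using that cfun.subspace_add[OF subW] cap_add by (metis (no_types, lifting) imageE image_eqI)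
      show "cscale d x \<in> cap ` W" if "x \<in> cap ` W" for d x
        using that cfun.subspace_scale[OF subW] cap_cscale by (metis (no_types, lifting) imageE image_eqI)
      show "cap ` W \<subseteq> gspace (tpow n)" using Wn cap_in_tpow by blast
      fix g assume g: "g \<in> G"
      show "gact (tpow n) g ` cap ` W \<subseteq> cap ` W"
        using stable[OF g] cap_equivariant[OF det[OF g], symmetric] by (auto simp only: gact_tpow)
    qed
    from iso obtain f where f: "bij_betw f W (gspace (M \<nu>))" "linear_on W f"
      and eq: "\<And>g x. g \<in> G \<Longrightarrow> x \<in> W \<Longrightarrow> f (tapp (diag_mat g) x) = gact (M \<nu>) g (f x)"
      by (auto simp: gmod_iso_def gact_tpow)
    define h where "h = f \<circ> the_inv_into W cap"
    have h: "h (cap x) = f x" if "x \<in> W" for x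
      using that inj by (simp add: h_def the_inv_into_f_f)
    have "bij_betw h (cap ` W) (gspace (M \<nu>))"
      unfolding h_def
      by (rule bij_betw_trans[OF bij_betw_the_inv_into f(1)]) (use inj in \<open>simp add: bij_betw_def\<close>)
    moreover have "linear_on (cap ` W) h"
      unfolding linear_on_def
      using f(2) h cfun.subspace_add[OF subW] cfun.subspace_scale[OF subW]
      by (auto simp only: cap_add[symmetric] cap_cscale[symmetric] linear_on_def ball_simps)
    moreover have "h (tapp (diag_mat g) y) = gact (M \<nu>) g (h y)" if g: "g \<in> G" and "y \<in> cap ` W" for g y
    proof -
      from \<open>y \<in> cap ` W\<close> obtain x where x: "x \<in> W" "y = cap x" by auto
      show ?thesis
        unfolding x(2) cap_equivariant[OF det[OF g], symmetric] h[OF stable[OF g x(1)]] h[OF x(1)]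
        by (rule eq[OF g x(1)])
    qed
    ultimately have "gmod_iso G (submod (tpow n) (cap ` W)) (M \<nu>)"
      unfolding gmod_iso_def by (auto simp: gact_tpow)
    then have "\<nu> \<in> Lev G \<Lambda> M (int n)"
      using sub \<nu>(1) by (auto simp: Lev_def)
    then show False using \<nu>(2) by simp
  qed
  ultimately show ?thesis using w by blast
qed

lemma mem_sub_tensor_V: "x \<in> sub_tensor_V U \<longleftrightarrow> x [] = 0 \<and> (\<forall>j. slice j x \<in> U)"
  by (simp add: sub_tensor_V_def slice_def)

lemma cap_in_subspace:
  assumes "cfun.subspace U" "x \<in> sub_tensor_V (sub_tensor_V U)"
  shows "cap x \<in> U"
  using assms by (simp add: cap_slice mem_sub_tensor_V cfun.subspace_diff)

lemma timage_temb:
  assumes f: "f \<in> tEnd n" "f \<odot> f = f"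
  shows "timage (Suc n) (temb f) = sub_tensor_V (timage n f)"
proof (intro equalityI subsetI)
  fix x assume "x \<in> timage (Suc n) (temb f)"
  then show "x \<in> sub_tensor_V (timage n f)"
    by (auto simp: timage_def mem_sub_tensor_V slice_tapp_temb tapp_temb_Nil intro!: imageI slice_in_tpow)
next
  fix x assume x: "x \<in> sub_tensor_V (timage n f)"
  have "tapp (temb f) x = x"
  proof (rule tensor_eqI)
    fix p j
    show "tapp (temb f) x (p @ [j]) = x (p @ [j])"
    proof -
      have "tapp f (slice j x) = slice j x"
        using x idempotent_fixes_image[OF f(2), of _ n] by (simp add: mem_sub_tensor_V)
      then show ?thesis unfolding tapp_temb_snoc by (simp add: slice_def)
    qed
  qed (use x in \<open>simp add: tapp_temb_Nil mem_sub_tensor_V\<close>)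
  moreover from this have "x \<in> gspace (tpow (Suc n))"
    using tapp_in_tpow[OF tEnd_temb[OF f(1)]] by metis
  ultimately show "x \<in> timage (Suc n) (temb f)"
    unfolding timage_def by (metis image_eqI)
qed

lemma sub_tensor_V_mono: "U \<subseteq> U' \<Longrightarrow> sub_tensor_V U \<subseteq> sub_tensor_V U'"
  unfolding mem_sub_tensor_V subset_iff by blast

section \<open>The partial trace of a projection\<close>

text \<open>
  Write \<open>t = 2 \<epsilon>(f)\<close>. It commutes with the group, and because the image of \<open>f\<close> lies in
  \<open>U \<otimes> V\<close>, the image of \<open>t\<close> lies in \<open>U\<close>; so \<open>t\<close> is a scalar \<open>c\<close> on \<open>U\<close>. Then
  \<open>p t = t\<close> and \<open>t p = c p\<close>, and comparing the traces of \<open>p t\<close> and \<open>t p\<close> gives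
  \<open>c \<cdot> dim U = tr t = tr f\<close>. The kernels of \<open>p\<close> and \<open>f\<close> are arbitrary here, so \<open>t\<close>
  need not be a multiple of \<open>p\<close>, but only its values on \<open>U\<close> are asserted.
\<close>

lemma cond_exp_idempotent_scalar:
  assumes det: "\<And>g. g \<in> G \<Longrightarrow> det g = 1"
    and p: "projects_onto G n p U M" and irr: "irreducible_gmod G M"
    and f: "f \<in> centralizer G (n + 1)" "f \<odot> f = f" "timage (n + 1) f \<subseteq> sub_tensor_V U"
    and x: "x \<in> U"
  shows "tapp (tscale 2 (cond_exp f)) x
    = cscale (of_nat (cfun.dim (timage (n + 1) f)) / of_nat (cfun.dim U)) x"
proof -
  let ?t = "tscale 2 (cond_exp f)"
  have pc: "p \<in> centralizer G n" "p \<odot> p = p" "timage n p = U" "gmod_iso G (submod (tpow n) U) M"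
    using p by (auto simp: projects_onto_def)
  have U: "is_submodule G (tpow n) U" using is_submodule_timage[OF pc(1)] pc(3) by simp
  have subU: "cfun.subspace U" and Un: "U \<subseteq> gspace (tpow n)" using U by (auto simp: is_submodule_def)
  have t: "?t \<in> centralizer G n" by (rule centralizer_cond_exp[OF det f(1)])
  have E: "p \<in> tEnd n" "?t \<in> tEnd n" "f \<in> tEnd (n + 1)" using pc(1) t f(1) by (auto simp: centralizer_iff)
  have tU: "tapp ?t y \<in> U" if "y \<in> gspace (tpow n)" for y
  proof -
    have "tapp (temb f) (cup y) \<in> timage (Suc (n + 1)) (temb f)"
      using cup_in_tpow[OF that] by (auto simp: timage_def)
    then have "tapp (temb f) (cup y) \<in> sub_tensor_V (sub_tensor_V U)"
      using timage_temb[OF E(3) f(2)] sub_tensor_V_mono[OF f(3)] by blast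
    then show ?thesis unfolding tapp_cond_exp by (rule cap_in_subspace[OF subU])
  qed
  have "\<exists>c. \<forall>x\<in>U. tapp ?t x = cscale c x"
    using schur_scalar[OF U pc(4) irr t] tU Un by blast
  then obtain c where c: "\<And>x. x \<in> U \<Longrightarrow> tapp ?t x = cscale c x" by blast
  have "p \<odot> ?t = ?t"
    using tU idempotent_fixes_image[OF pc(2), of _ n] unfolding pc(3)
    by (intro tmat_eqI[of _ n] tEnd_tmul E) (simp only: tapp_tmul)
  moreover have "?t \<odot> p = tscale c p"
    using c pc(3) by (intro tmat_eqI[of _ n] tEnd_tmul tEnd_tscale E) (auto simp: tapp_tmul tapp_tscale timage_def)
  ultimately have "ttrace n ?t = c * ttrace n p"
    by (metis ttrace_tmul_commute ttrace_tscale)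
  moreover have "ttrace n ?t = of_nat (cfun.dim (timage (n + 1) f))"
    using ttrace_cond_exp[of n f] ttrace_idempotent[OF E(3) f(2)] by (simp add: ttrace_tscale)
  ultimately have c_eq: "of_nat (cfun.dim (timage (n + 1) f)) = c * of_nat (cfun.dim U)"
    using ttrace_idempotent[OF E(1) pc(2)] pc(3) by simp
  have "cfun.dim U \<noteq> 0"
    using dim_nonzero[OF U pc(4) irr] .
  then show ?thesis using c[OF x] c_eq by simp
qed

section \<open>The new projection\<close>

theorem proposition1p43:
  fixes G :: "(complex^2^2) set"
    and \<Lambda> :: "'l set" and M :: "'l \<Rightarrow> 'b gmod" and a :: "'l \<Rightarrow> 'l \<Rightarrow> nat"
    and k :: nat and \<alpha> \<nu> :: 'l
    and I :: "'i set" and \<mu> :: "'i \<Rightarrow> 'l" and i :: 'i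
    and f\<^sub>\<alpha> f\<^sub>\<nu> :: tmat and f :: "'i \<Rightarrow> tmat"
    and U\<^sub>\<alpha> :: "tensor set" and U :: "'i \<Rightarrow> tensor set" and W :: "'l \<Rightarrow> tensor set"
  assumes "subgroup G SU2" and "G \<noteq> {mat 1}" and "G \<noteq> {mat 1, - mat 1}"
    and "\<forall>n. completely_reducible G (tpow n)"
    and "is_irrep_system G \<Lambda> M"
    and "admissible_rule G \<Lambda> M a"
    and "\<alpha> \<in> Lev G \<Lambda> M (int k)"
    and "projects_onto G k f\<^sub>\<alpha> U\<^sub>\<alpha> (M \<alpha>)" and "U\<^sub>\<alpha> \<subseteq> V_new G \<Lambda> M k"
    and "is_direct_sum (sub_tensor_V U\<^sub>\<alpha>) I U"
    and "\<forall>j\<in>I. \<mu> j \<in> \<Lambda> \<and> projects_onto G (k + 1) (f j) (U j) (M (\<mu> j))"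
    and "\<forall>j\<in>I. \<forall>l\<in>I. j \<noteq> l \<longrightarrow> f j \<odot> f l = 0"
    and "i \<in> I" and "\<mu> i \<in> Lev G \<Lambda> M (int k + 1) - Lev G \<Lambda> M (int k - 1)"
    and "\<nu> \<in> Lev G \<Lambda> M (int k + 2) - Lev G \<Lambda> M (int k)"
    and "is_direct_sum (sub_tensor_V (U i)) {\<alpha>, \<nu>} W"
    and "\<forall>\<kappa>\<in>{\<alpha>, \<nu>}. is_submodule G (tpow (k + 2)) (W \<kappa>) \<and>
           gmod_iso G (submod (tpow (k + 2)) (W \<kappa>)) (M \<kappa>)"
    and "f\<^sub>\<nu> = temb (f i) - tscale (of_nat (gdim (M \<alpha>)) / of_nat (gdim (M (\<mu> i))))
           (temb (f i) \<odot> tl_e (k + 2) (k + 1) \<odot> temb (f i))"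
  shows "(f\<^sub>\<nu> \<in> centralizer G (k + 2) \<and> f\<^sub>\<nu> \<odot> f\<^sub>\<nu> = f\<^sub>\<nu>) \<and>
    (temb (f i) \<odot> f\<^sub>\<nu> = f\<^sub>\<nu> \<and> f\<^sub>\<nu> \<odot> temb (f i) = f\<^sub>\<nu>) \<and>
    (\<forall>j n. k + 2 < j \<and> j < n \<longrightarrow>
       (temb ^^ (n - (k + 2))) f\<^sub>\<nu> \<odot> tl_e n j = tl_e n j \<odot> (temb ^^ (n - (k + 2))) f\<^sub>\<nu>) \<and>
    (tl_e (k + 3) (k + 2) \<odot> temb f\<^sub>\<nu> \<odot> tl_e (k + 3) (k + 2) =
       tscale (of_nat (gdim (M \<nu>)) / of_nat (gdim (M (\<mu> i))))
         (temb (temb (f i)) \<odot> tl_e (k + 3) (k + 2)) \<and>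
     cond_exp f\<^sub>\<nu> = tscale (of_nat (gdim (M \<nu>)) / (2 * of_nat (gdim (M (\<mu> i))))) (f i)) \<and>
    projects_onto G (k + 2) f\<^sub>\<nu> (W \<nu>) (M \<nu>)"
proof -
  have det: "det g = 1" if "g \<in> G" for g
    using subgroup.subset[OF assms(1)] that by (auto simp: SU2_def)
  have irr: "irreducible_gmod G (M \<kappa>)" if "\<kappa> \<in> \<Lambda>" for \<kappa>
    using assms(5) that by (auto simp: is_irrep_system_def)
  have \<alpha>: "\<alpha> \<in> \<Lambda>" and \<nu>: "\<nu> \<in> \<Lambda>" "\<nu> \<notin> Lev G \<Lambda> M (int k)" and \<mu>: "\<mu> i \<in> \<Lambda>"
    using assms(7,14,15) by (auto simp: Lev_def)
  have ne: "\<alpha> \<noteq> \<nu>" using assms(7) \<nu>(2) by auto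
  \<comment> \<open>\<open>P\<close> and \<open>E\<close> are \<open>f\<^sub>\<mu>\<close> and \<open>e\<^sub>k\<^sub>+\<^sub>1\<close> at level \<open>k + 2\<close>, and \<open>f\<^sub>\<nu> = P - r X\<close>.\<close>
  define F where "F = f i"
  define P where "P = temb F"
  define E where "E = tl_e (k + 2) (k + 1)"
  define X where "X = P \<odot> E \<odot> P"
  define c :: complex where "c = of_nat (gdim (M (\<mu> i))) / of_nat (gdim (M \<alpha>))"
  define r :: complex where "r = of_nat (gdim (M \<alpha>)) / of_nat (gdim (M (\<mu> i)))"

  have p\<alpha>: "f\<^sub>\<alpha> \<in> centralizer G k" "timage k f\<^sub>\<alpha> = U\<^sub>\<alpha>" "gmod_iso G (submod (tpow k) U\<^sub>\<alpha>) (M \<alpha>)"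
    using assms(8) by (auto simp: projects_onto_def)
  have F: "F \<in> centralizer G (k + 1)" "F \<odot> F = F" "timage (k + 1) F = U i"
    "gmod_iso G (submod (tpow (k + 1)) (U i)) (M (\<mu> i))"
    using assms(11,13) by (auto simp: projects_onto_def F_def)
  have U\<^sub>\<alpha>: "is_submodule G (tpow k) U\<^sub>\<alpha>" using is_submodule_timage[OF p\<alpha>(1)] p\<alpha>(2) by simp
  have Ui: "is_submodule G (tpow (k + 1)) (U i)" using is_submodule_timage[OF F(1)] F(3) by simp
  have W: "is_submodule G (tpow (k + 2)) (W \<kappa>)" "gmod_iso G (submod (tpow (k + 2)) (W \<kappa>)) (M \<kappa>)"
    if "\<kappa> \<in> {\<alpha>, \<nu>}" for \<kappa>
    using assms(17) that by blast+
  have sub\<alpha>: "cfun.subspace U\<^sub>\<alpha>" using U\<^sub>\<alpha> by (simp add: is_submodule_def)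
  have Ui_sub: "U i \<subseteq> sub_tensor_V U\<^sub>\<alpha>" using assms(10,13) by (auto simp: is_direct_sum_def)
  have d\<alpha>: "gdim (M \<alpha>) = cfun.dim U\<^sub>\<alpha>" "gdim (M \<alpha>) \<noteq> 0"
    using gdim_submodule[OF U\<^sub>\<alpha> p\<alpha>(3)] dim_nonzero[OF U\<^sub>\<alpha> p\<alpha>(3) irr[OF \<alpha>]] by simp_all
  have d\<mu>: "gdim (M (\<mu> i)) = cfun.dim (U i)" "gdim (M (\<mu> i)) \<noteq> 0"
    using gdim_submodule[OF Ui F(4)] dim_nonzero[OF Ui F(4) irr[OF \<mu>]] by simp_all
  have rc: "r * c = 1" using d\<alpha>(2) d\<mu>(2) by (simp add: r_def c_def)

  have FE: "F \<in> tEnd (k + 1)" using F(1) by (simp add: centralizer_iff)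
  have P: "P \<in> centralizer G (k + 2)" "P \<odot> P = P" "timage (k + 2) P = sub_tensor_V (U i)"
    using centralizer_temb[OF F(1)] F(2,3) timage_temb[OF FE F(2)] by (simp_all add: P_def temb_tmul[symmetric])
  have PE: "P \<in> tEnd (k + 2)" using P(1) by (simp add: centralizer_iff)
  have E: "E \<in> centralizer G (k + 2)" unfolding E_def by (rule centralizer_tl_e_last[OF det])
  have EE: "E \<in> tEnd (k + 2)" using E by (simp add: centralizer_iff)
  have X: "X \<in> centralizer G (k + 2)" unfolding X_def by (intro centralizer_tmul P E)
  have XE: "X \<in> tEnd (k + 2)" using X by (simp add: centralizer_iff)
  have f\<nu>: "f\<^sub>\<nu> = P - tscale r X"
    unfolding assms(18) X_def P_def E_def r_def F_def ..

  have PX: "P \<odot> X = X" by (simp add: X_def tmul_assoc[symmetric] P(2))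
  have XP: "X \<odot> P = X" by (simp add: X_def tmul_assoc P(2))
  \<comment> \<open>The contraction of a vector in the image of \<open>P\<close> lies in \<open>U\<^sub>\<alpha>\<close>, where \<open>2 \<epsilon>(F)\<close> is the scalar \<open>c\<close>.\<close>
  have XX: "X \<odot> X = tscale c X"
  proof (rule tmat_eqI[OF tEnd_tmul[OF XE XE] tEnd_tscale[OF XE]])
    fix x assume x: "x \<in> gspace (tpow (k + 2))"
    define y where "y = tapp P x"
    have "y \<in> sub_tensor_V (U i)"
      using x P(3) by (auto simp: y_def timage_def)
    then have y: "cap y \<in> U\<^sub>\<alpha>"
      using cap_in_subspace[OF sub\<alpha>] sub_tensor_V_mono[OF Ui_sub] by blast
    have PP: "tapp P (tapp P z) = tapp P z" for z by (simp add: tapp_tmul[symmetric] P(2))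
    have cup_cap: "tapp E (tapp P z) = cup (cap (tapp P z))" for z
      unfolding E_def by (rule tl_e_eq_cup_cap[OF tapp_in_tpow[OF PE]])
    have Ey: "tapp E y = cup (cap y)" unfolding y_def by (rule cup_cap)
    have "cap (tapp P (cup (cap y))) = cscale c (cap y)"
      using cond_exp_idempotent_scalar[OF det assms(8) irr[OF \<alpha>] F(1,2) _ y] F(3) Ui_sub
      unfolding P_def by (simp add: tapp_cond_exp c_def d\<alpha>(1) d\<mu>(1))
    then have "tapp E (tapp P (tapp E y)) = cscale c (tapp E y)"
      by (simp only: cup_cap Ey cup_cscale)
    then show "tapp (X \<odot> X) x = tapp (tscale c X) x"
      by (simp only: X_def tapp_tmul tapp_tscale PP y_def[symmetric] tapp_cscale)
  qed

  \<comment> \<open>Both sides are the dimension of the copy of \<open>G\<^sup>\<mu> \<otimes> V\<close>; the left one as the trace of \<open>P\<close>.\<close>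
  have dim_sum: "2 * gdim (M (\<mu> i)) = gdim (M \<alpha>) + gdim (M \<nu>)"
  proof -
    have "(of_nat (cfun.dim (sub_tensor_V (U i))) :: complex) = of_nat (2 * cfun.dim (U i))"
      using ttrace_temb[of "k + 1" F] ttrace_idempotent[OF FE F(2)] ttrace_idempotent[OF PE P(2)] F(3) P(3)
      by (simp add: P_def)
    then have "cfun.dim (sub_tensor_V (U i)) = 2 * cfun.dim (U i)" by (simp only: of_nat_eq_iff)
    moreover have "cfun.dim (sub_tensor_V (U i)) = cfun.dim (W \<alpha>) + cfun.dim (W \<nu>)"
    proof (rule dim_direct_sum_2[OF assms(16) ne])
      show "cfun.subspace (sub_tensor_V (U i))" using subspace_timage[of "k + 2" P] P(3) by simp
      show "finite (unit_tensor ` {q. length q = k + 2})" using finite_words by blast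
      show "sub_tensor_V (U i) \<subseteq> cfun.span (unit_tensor ` {q. length q = k + 2})"
        using timage_subset_tpow[OF PE] P(3) tpow_subset_span by blast
    qed
    ultimately show ?thesis
      using gdim_submodule[OF W(1) W(2)] d\<mu>(1) by simp
  qed

  have ce: "cond_exp f\<^sub>\<nu> = tscale (of_nat (gdim (M \<nu>)) / (2 * of_nat (gdim (M (\<mu> i))))) F"
  proof -
    have "cond_exp X = F \<odot> cond_exp E \<odot> F"
      unfolding X_def P_def by (simp add: cond_exp_temb_right cond_exp_temb_left)
    also have "\<dots> = tscale (1/2) F"
    proof (rule tmat_eqI[of _ "k + 1"])
      have "cond_exp E \<in> tEnd (k + 1)" using EE by (intro tEnd_cond_exp) simp
      then show "F \<odot> cond_exp E \<odot> F \<in> tEnd (k + 1)" by (intro tEnd_tmul FE)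
      show "tscale (1/2) F \<in> tEnd (k + 1)" by (rule tEnd_tscale[OF FE])
      show "tapp (F \<odot> cond_exp E \<odot> F) x = tapp (tscale (1/2) F) x" for x
        using tapp_cond_exp_tl_e[OF tapp_in_tpow[OF FE], of x]
        by (simp add: E_def tapp_tmul tapp_tscale tapp_cscale tapp_tmul[of F F, symmetric] F(2))
    qed
    finally have "cond_exp f\<^sub>\<nu> = F - tscale r (tscale (1/2) F)"
      by (simp add: f\<nu> cond_exp_diff cond_exp_tscale P_def cond_exp_temb)
    moreover have "of_nat (gdim (M \<nu>)) / (2 * of_nat (gdim (M (\<mu> i)))) = 1 - r / 2"
    proof -
      have "of_nat (gdim (M \<nu>)) = 2 * of_nat (gdim (M (\<mu> i))) - (of_nat (gdim (M \<alpha>)) :: complex)"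
        using arg_cong[OF dim_sum, of "of_nat :: nat \<Rightarrow> complex"] by simp
      then show ?thesis using d\<mu>(2) by (simp add: r_def field_simps)
    qed
    ultimately show ?thesis by (simp add: tscale_def fun_eq_iff left_diff_distrib)
  qed

  have Z: "f\<^sub>\<nu> \<in> centralizer G (k + 2)"
    unfolding f\<nu> by (intro centralizer_diff centralizer_tscale P X)
  then have ZE: "f\<^sub>\<nu> \<in> tEnd (k + 2)" by (simp add: centralizer_iff)
  have Pf: "P \<odot> f\<^sub>\<nu> = f\<^sub>\<nu>" "f\<^sub>\<nu> \<odot> P = f\<^sub>\<nu>"
    unfolding f\<nu> by (simp_all add: tmul_diff_left tmul_diff_right tmul_tscale_left tmul_tscale_right P(2) PX XP)
  have idem: "f\<^sub>\<nu> \<odot> f\<^sub>\<nu> = f\<^sub>\<nu>"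
  proof -
    have "X \<odot> f\<^sub>\<nu> = X - tscale (r * c) X"
      unfolding f\<nu> tmul_diff_right tmul_tscale_right XP XX by (simp add: tscale_def mult.assoc)
    then have "X \<odot> f\<^sub>\<nu> = 0" by (simp add: rc tscale_def fun_eq_iff)
    moreover have "f\<^sub>\<nu> \<odot> f\<^sub>\<nu> = P \<odot> f\<^sub>\<nu> - tscale r (X \<odot> f\<^sub>\<nu>)"
      by (subst (1) f\<nu>) (simp only: tmul_diff_left tmul_tscale_left)
    ultimately show ?thesis by (simp add: Pf(1)) (simp add: tscale_def fun_eq_iff)
  qed

  have sandwich: "tl_e (k + 3) (k + 2) \<odot> temb f\<^sub>\<nu> \<odot> tl_e (k + 3) (k + 2) =
       tscale (of_nat (gdim (M \<nu>)) / of_nat (gdim (M (\<mu> i)))) (temb (temb F) \<odot> tl_e (k + 3) (k + 2))"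
  proof -
    have lev: "k + 1 + 2 = k + 3" "k + 1 + 1 = k + 2" by simp_all
    have "tscale 2 (cond_exp f\<^sub>\<nu>) = tscale (of_nat (gdim (M \<nu>)) / of_nat (gdim (M (\<mu> i)))) F"
      by (simp add: ce tscale_def)
    then show ?thesis
      using tl_e_sandwich[of f\<^sub>\<nu> "k + 1", unfolded lev] ZE
      by (simp only: temb_tscale tmul_tscale_left)
  qed

  \<comment> \<open>One inclusion holds because \<open>e\<^sub>k\<^sub>+\<^sub>1\<close> kills \<open>W \<nu>\<close>, the other by comparing dimensions.\<close>
  have "W \<nu> = timage (k + 2) f\<^sub>\<nu>"
  proof (rule subspace_eq_of_dim_le)
    show "cfun.subspace (W \<nu>)" using W(1)[of \<nu>] by (simp add: is_submodule_def)
    show "W \<nu> \<subseteq> timage (k + 2) f\<^sub>\<nu>"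
    proof
      fix w assume w: "w \<in> W \<nu>"
      have wt: "w \<in> gspace (tpow (k + 2))" using W(1)[of \<nu>] w by (auto simp: is_submodule_def)
      have "w \<in> timage (k + 2) P" using assms(16) w P(3) by (auto simp: is_direct_sum_def)
      then have Pw: "tapp P w = w" by (rule idempotent_fixes_image[OF P(2)])
      have "cap w = 0" using W[of \<nu>] by (intro cap_vanishes[OF det _ _ irr[OF \<nu>(1)] \<nu> w]) simp_all
      then have "tapp E w = 0" unfolding E_def tl_e_eq_cup_cap[OF wt] by (simp only: cup_zero)
      then have "tapp X w = 0" by (simp only: X_def tapp_tmul Pw tapp_zero)
      then have "tapp f\<^sub>\<nu> w = w" by (simp add: f\<nu> tapp_diff_mat tapp_tscale Pw)
      then show "w \<in> timage (k + 2) f\<^sub>\<nu>" using wt unfolding timage_def by (metis image_eqI)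
    qed
    have "ttrace (k + 2) f\<^sub>\<nu> = of_nat (gdim (M \<nu>))"
      using ttrace_cond_exp[of "k + 1" f\<^sub>\<nu>] ttrace_idempotent[OF FE F(2)] F(3) d\<mu>
      by (simp add: ce ttrace_tscale)
    then have "cfun.dim (timage (k + 2) f\<^sub>\<nu>) = gdim (M \<nu>)"
      using ttrace_idempotent[OF ZE idem] by (simp only: of_nat_eq_iff)
    then show "cfun.dim (timage (k + 2) f\<^sub>\<nu>) \<le> cfun.dim (W \<nu>)"
      using gdim_submodule[OF W(1) W(2)] by simp
    show "finite (unit_tensor ` {q. length q = k + 2})" using finite_words by blast
    show "timage (k + 2) f\<^sub>\<nu> \<subseteq> cfun.span (unit_tensor ` {q. length q = k + 2})"
      using timage_subset_tpow[OF ZE] tpow_subset_span by blast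
  qed
  then have "projects_onto G (k + 2) f\<^sub>\<nu> (W \<nu>) (M \<nu>)"
    using Z idem W(2)[of \<nu>] by (simp add: projects_onto_def)
  then show ?thesis
    using Z idem Pf sandwich ce tl_e_commute[OF ZE] unfolding P_def F_def by blast
qed

end
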